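(* Let $\mathcal{L} \subset \mathbb{P}^{2}_{\mathbb{C}}$ be a plus-one generated arrangement of $d>12$ lines, and let $m(\mathcal{L})$ be the maximal multiplicity among the intersection points of $\mathcal{L}$. Then $m(\mathcal{L}) \geq 4$.
   Context: Let $S=\mathbb{C}[x,y,z]$ with its standard grading. An arrangement of $d$ lines $\mathcal{L}\subset\mathbb{P}^2_{\mathbb{C}}$ is a set of $d$ pairwise distinct lines; it is regarded as the reduced plane curve $f=0$ of degree $d$, where $f\in S$ is the product of linear forms defining the lines. The multiplicity of an intersection point is the number of lines of $\mathcal{L}$ through it. For a reduced plane curve $C:f=0$ of degree $d$, let $J_f=\langle \partial_x f,\partial_y f,\partial_z f\rangle$ be the Jacobian ideal and $M(f)=S/J_f$ the Milnor algebra. $C$ is an $m$-syzygy curve with exponents $(d_1,\ldots,d_m)$ if $M(f)$ has a minimal graded free resolution $$0 \rightarrow \bigoplus_{i=1}^{m-2}S(-e_{i}) \rightarrow \bigoplus_{i=1}^{m}S(1-d - d_{i}) \rightarrow S^{3}(1-d)\rightarrow S \rightarrow M(f) \rightarrow 0$$ with $e_1\le\cdots\le e_{m-2}$ and $1\le d_1\le\cdots\le d_m$. $C$ is plus-one generated with exponents $(d_1,d_2,d_3)$ if it is a $3$-syzygy curve with these exponents and $d_1+d_2=d$. *)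

theory Defs
  imports
    "HOL-Library.Poly_Mapping"
    "HOL-Library.Numeral_Type"
    "Jordan_Normal_Form.Matrix_Kernel"
begin

section \<open>The polynomial ring in three variables\<close>

text \<open>
  A polynomial in \<open>\<complex>[x,y,z]\<close> is a finitely supported map from monomials to coefficients. A monomial
  is its exponent vector, indexed by the three-element type \<open>3\<close>; the ring structure of
  \<^theory>\<open>HOL-Library.Poly_Mapping\<close> is the convolution product.
\<close>

type_synonym monom3 = "3 \<Rightarrow>\<^sub>0 nat"
type_synonym poly3 = "monom3 \<Rightarrow>\<^sub>0 complex"

text \<open>The degree is an integer so that it can be a difference of twists. The zero polynomial is
  homogeneous of every degree, and it is the only one homogeneous of a negative degree.\<close>

definition homogeneous :: "int \<Rightarrow> poly3 \<Rightarrow> bool" where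
  "homogeneous n p \<longleftrightarrow>
     (\<forall>m \<in> Poly_Mapping.keys p. (\<Sum>i\<in>UNIV. int (Poly_Mapping.lookup m i)) = n)"

definition irrelevant_ideal :: "poly3 set" where
  "irrelevant_ideal = {p. Poly_Mapping.lookup p 0 = 0}"

definition evaluate :: "poly3 \<Rightarrow> (3 \<Rightarrow> complex) \<Rightarrow> complex" where
  "evaluate p v =
     (\<Sum>m \<in> Poly_Mapping.keys p. Poly_Mapping.lookup p m * (\<Prod>i\<in>UNIV. v i ^ Poly_Mapping.lookup m i))"

text \<open>If the exponent of the variable \<open>i\<close> in \<open>m\<close> is zero, then the truncated subtraction leaves \<open>m\<close>
  unchanged, but the coefficient of the term vanishes.\<close>

definition partial_deriv :: "3 \<Rightarrow> poly3 \<Rightarrow> poly3" where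
  "partial_deriv i p =
     (\<Sum>m \<in> Poly_Mapping.keys p.
        Poly_Mapping.single (m - Poly_Mapping.single i 1)
          (of_nat (Poly_Mapping.lookup m i) * Poly_Mapping.lookup p m))"

text \<open>The span in the \<^typ>\<open>poly3\<close>-module \<^typ>\<open>poly3\<close>, that is, the ideal generated by the partial
  derivatives.\<close>

definition jacobian_ideal :: "poly3 \<Rightarrow> poly3 set" where
  "jacobian_ideal f = Modules.module.span (*) (range (\<lambda>i. partial_deriv i f))"

section \<open>Graded free resolutions\<close>

text \<open>
  A list \<open>a\<close> of integers of length \<open>n\<close> stands for the graded free module
  \<open>S(a\<^sub>0) \<oplus> \<dots> \<oplus> S(a\<^sub>n\<^sub>-\<^sub>1)\<close>, whose underlying module is \<open>carrier_vec n\<close>. As the basis element of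
  \<open>S(a)\<close> has degree \<open>-a\<close>, a homomorphism \<open>S(b) \<rightarrow> S(a)\<close> of degree zero is multiplication by a
  homogeneous polynomial of degree \<open>a - b\<close>.
\<close>

definition graded_map :: "int list \<Rightarrow> int list \<Rightarrow> poly3 mat \<Rightarrow> bool" where
  "graded_map b a A \<longleftrightarrow>
     A \<in> carrier_mat (length a) (length b) \<and>
     (\<forall>i < length a. \<forall>j < length b. homogeneous (a ! i - b ! j) (A $$ (i, j)))"

definition mat_image :: "poly3 mat \<Rightarrow> poly3 vec set" where
  "mat_image A = (\<lambda>v. A *\<^sub>v v) ` carrier_vec (dim_col A)"

text \<open>
  The complex \<open>0 \<rightarrow> F3 \<rightarrow> F2 \<rightarrow> F1 \<rightarrow> S \<rightarrow> S/I \<rightarrow> 0\<close> with maps \<open>\<phi>3\<close>, \<open>\<phi>2\<close>, \<open>\<phi>1\<close> and the canonical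
  projection is exact, and each \<open>\<phi>k\<close> maps its source into the irrelevant ideal times its target.
  Exactness at \<open>S\<close> says that the image of \<open>\<phi>1\<close> is \<open>I\<close>.
\<close>

definition minimal_graded_free_resolution ::
  "poly3 set \<Rightarrow> int list \<Rightarrow> int list \<Rightarrow> int list \<Rightarrow> poly3 mat \<Rightarrow> poly3 mat \<Rightarrow> poly3 mat \<Rightarrow> bool" where
  "minimal_graded_free_resolution I F3 F2 F1 \<phi>3 \<phi>2 \<phi>1 \<longleftrightarrow>
     graded_map F3 F2 \<phi>3 \<and> graded_map F2 F1 \<phi>2 \<and> graded_map F1 [0] \<phi>1 \<and>
     mat_kernel \<phi>3 = {0\<^sub>v (length F3)} \<and>
     mat_kernel \<phi>2 = mat_image \<phi>3 \<and>
     mat_kernel \<phi>1 = mat_image \<phi>2 \<and>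
     mat_image \<phi>1 = {v \<in> carrier_vec 1. v $ 0 \<in> I} \<and>
     elements_mat \<phi>3 \<union> elements_mat \<phi>2 \<union> elements_mat \<phi>1 \<subseteq> irrelevant_ideal"

section \<open>Syzygy curves and plus-one generated curves\<close>

text \<open>The argument \<open>d\<close> is the degree of the curve \<open>f = 0\<close>, and \<open>m\<close> is the length of the list \<open>ds\<close> of
  exponents.\<close>

definition syzygy_curve :: "nat \<Rightarrow> poly3 \<Rightarrow> nat list \<Rightarrow> bool" where
  "syzygy_curve d f ds \<longleftrightarrow>
     sorted ds \<and> (\<forall>k \<in> set ds. 1 \<le> k) \<and>
     (\<exists>es :: int list. \<exists>\<phi>3 \<phi>2 \<phi>1.
        length ds = length es + 2 \<and> sorted es \<and>
        minimal_graded_free_resolution (jacobian_ideal f)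
          (map (\<lambda>e. - e) es)
          (map (\<lambda>k. 1 - int d - int k) ds)
          (replicate 3 (1 - int d))
          \<phi>3 \<phi>2 \<phi>1)"

definition plus_one_generated_curve :: "nat \<Rightarrow> poly3 \<Rightarrow> nat \<Rightarrow> nat \<Rightarrow> nat \<Rightarrow> bool" where
  "plus_one_generated_curve d f d1 d2 d3 \<longleftrightarrow> syzygy_curve d f [d1, d2, d3] \<and> d1 + d2 = d"

section \<open>Line arrangements in the projective plane\<close>

text \<open>A point of the projective plane is a one-dimensional subspace of \<open>\<complex>\<^sup>3\<close>.\<close>

type_synonym point = "(3 \<Rightarrow> complex) set"

definition proj_plane :: "point set" where
  "proj_plane = {range (\<lambda>c i. c * v i) |v. v \<noteq> (\<lambda>i. 0)}"

definition linear_form :: "poly3 \<Rightarrow> bool" where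
  "linear_form l \<longleftrightarrow> l \<noteq> 0 \<and> homogeneous 1 l"

definition zero_locus :: "poly3 \<Rightarrow> point set" where
  "zero_locus p = {P \<in> proj_plane. \<forall>v \<in> P. evaluate p v = 0}"

definition proj_lines :: "point set set" where
  "proj_lines = {zero_locus l |l. linear_form l}"

definition line_arrangement :: "point set set \<Rightarrow> bool" where
  "line_arrangement \<L> \<longleftrightarrow> finite \<L> \<and> \<L> \<subseteq> proj_lines"

text \<open>A linear form defining a given line is unique up to a nonzero scalar, and hence so is the
  defining polynomial of an arrangement.\<close>

definition defining_polynomial :: "point set set \<Rightarrow> poly3 \<Rightarrow> bool" where
  "defining_polynomial \<L> f \<longleftrightarrow>
     (\<exists>l. (\<forall>L\<in>\<L>. linear_form (l L) \<and> zero_locus (l L) = L) \<and> f = (\<Prod>L\<in>\<L>. l L))"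

definition plus_one_generated_arrangement :: "point set set \<Rightarrow> bool" where
  "plus_one_generated_arrangement \<L> \<longleftrightarrow>
     line_arrangement \<L> \<and>
     (\<exists>f d1 d2 d3. defining_polynomial \<L> f \<and> plus_one_generated_curve (card \<L>) f d1 d2 d3)"

definition intersection_points :: "point set set \<Rightarrow> point set" where
  "intersection_points \<L> = {P. \<exists>L\<in>\<L>. \<exists>L'\<in>\<L>. L \<noteq> L' \<and> P \<in> L \<and> P \<in> L'}"

definition multiplicity_at :: "point set set \<Rightarrow> point \<Rightarrow> nat" where
  "multiplicity_at \<L> P = card {L \<in> \<L>. P \<in> L}"

text \<open>The maximum is over a nonempty finite set as soon as the arrangement has at least two lines.\<close>

definition max_multiplicity :: "point set set \<Rightarrow> nat" where
  "max_multiplicity \<L> = Max (multiplicity_at \<L> ` intersection_points \<L>)"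

end

theory Submission
  imports Defs "HOL-Analysis.Analysis"
begin

no_notation Matrix.vec_index (infixl "$" 100)

text \<open>
  If all points of the arrangement have multiplicity at most three, then a nonzero polynomial vector
  field \<open>T\<close> of degree \<open>r\<close> with \<open>T f = 0\<close> satisfies \<open>r \<ge> 2 d / 3 - 2\<close>. A plus-one generated
  arrangement has such a field with \<open>r = d\<^sub>1 \<le> d / 2\<close>, the first column of the second map of the
  resolution, and so \<open>d \<le> 12\<close>.

  The bound is the one of Dimca and Saito for line arrangements; here it is obtained by integration.
  Put \<open>s = (r + 2) / d\<close>. If \<open>s < 2 / 3\<close> then \<open>\<bar>f\<bar> powr (-2 * s)\<close> is locally integrable away from
  the origin, since the worst singularity is a product of three linear forms in two variables.
  Multiply the part of \<open>T\<close> orthogonal to the radial direction by \<open>\<bar>f\<bar> powr (-2 * s)\<close>, by a radial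
  cutoff and by a test function \<open>\<psi>\<close>. With this exponent all terms that involve the radial direction
  cancel in the complex divergence, so its integral, which is zero, involves only \<open>\<psi>\<close> times the
  divergence of \<open>T\<close> and the derivative of \<open>\<psi>\<close>. Two choices of \<open>\<psi>\<close> make the integrand nonnegative and
  show first that \<open>T\<close> is divergence free and then that it is radial; by Euler's identity \<open>T f = 0\<close>
  then forces \<open>T = 0\<close>.
\<close>

text \<open>All \<open>d\<close> forms vanish at the origin, where |f|^(-2 s) has real degree -2 (r
  + 2). This is at most -6 because \<open>r\<close> is at least 1, so the weight is not integrable
  in real dimension 6. Hence the cutoff to a shell, and with it a radial boundary term. Removing the
  radial part of \<open>T\<close> kills that term but destroys tangency: up to a common factor, the
  new field sends f to -d S f, where S is the Hermitian product of \<open>T\<close> with v. Through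
  the weight this contributes s d S, and the divergence of the projected field contributes -(r + 2)
  S; the two cancel exactly for s = (r + 2) / d. Since the weight is singular on the lines, it is
  first replaced by (|f|^2 + \<epsilon>)^(-s). The divergence has to be removed first, because in
  the second application its term has no sign. On the algebraic side, a resolution fixes the
  generators of the Jacobian ideal only up to a choice. Its column is a relation among the entries
  of the first map, not among the partial derivatives, and has to be transported by an invertible
  constant matrix.\<close>

section \<open>Polynomials in three variables as functions\<close>

lemma evaluate_eq_sum:
  assumes "finite A" and "Poly_Mapping.keys p \<subseteq> A"
  shows "evaluate p v =
    (\<Sum>m\<in>A. Poly_Mapping.lookup p m * (\<Prod>i\<in>UNIV. v i ^ Poly_Mapping.lookup m i))"
  unfolding evaluate_def using assms
  by (intro sum.mono_neutral_left) (auto simp: Poly_Mapping.in_keys_iff)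

lemma evaluate_zero [simp]: "evaluate 0 v = 0"
  by (simp add: evaluate_def)

lemma evaluate_single [simp]:
  "evaluate (Poly_Mapping.single m c) v = c * (\<Prod>i\<in>UNIV. v i ^ Poly_Mapping.lookup m i)"
  by (subst evaluate_eq_sum[of "{m}"]) (auto simp: Poly_Mapping.lookup_single)

lemma evaluate_one [simp]: "evaluate 1 v = 1"
  by (simp flip: Poly_Mapping.single_one)

lemma evaluate_add [simp]: "evaluate (p + q) v = evaluate p v + evaluate q v"
proof -
  let ?A = "Poly_Mapping.keys p \<union> Poly_Mapping.keys q"
  show ?thesis
    using Poly_Mapping.keys_add[of p q]
    by (simp add: evaluate_eq_sum[of ?A p] evaluate_eq_sum[of ?A q] evaluate_eq_sum[of ?A "p + q"]
        Poly_Mapping.lookup_add algebra_simps sum.distrib)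
qed

lemma evaluate_sum [simp]: "evaluate (\<Sum>a\<in>A. p a) v = (\<Sum>a\<in>A. evaluate (p a) v)"
  by (induction A rule: infinite_finite_induct) auto

lemma sum_single_lookup: "(\<Sum>m\<in>Poly_Mapping.keys p. Poly_Mapping.single m (Poly_Mapping.lookup p m)) = p"
  by (intro poly_mapping_eqI)
    (auto simp: Poly_Mapping.lookup_sum Poly_Mapping.lookup_single when_def Poly_Mapping.in_keys_iff)

lemma evaluate_mult [simp]: "evaluate (p * q) v = evaluate p v * evaluate q v"
proof -
  have "p * q = (\<Sum>m\<in>Poly_Mapping.keys p. Poly_Mapping.single m (Poly_Mapping.lookup p m)) *
      (\<Sum>n\<in>Poly_Mapping.keys q. Poly_Mapping.single n (Poly_Mapping.lookup q n))"
    by (simp add: sum_single_lookup)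
  also have "evaluate \<dots> v = evaluate p v * evaluate q v"
    by (simp add: sum_product Poly_Mapping.mult_single Poly_Mapping.lookup_add power_add
        prod.distrib evaluate_def[of p] evaluate_def[of q] mult_ac)
  finally show ?thesis .
qed

lemma evaluate_prod [simp]: "evaluate (\<Prod>a\<in>A. p a) v = (\<Prod>a\<in>A. evaluate (p a) v)"
  by (induction A rule: infinite_finite_induct) auto

lemma evaluate_at_0: "evaluate p (\<lambda>_. 0) = Poly_Mapping.lookup p 0"
proof -
  have "(\<Prod>i\<in>UNIV. (0::complex) ^ Poly_Mapping.lookup m i) = (if m = 0 then 1 else 0)"
    for m :: monom3
    by (auto intro!: poly_mapping_eqI)
  hence "evaluate p (\<lambda>_. 0) =
      (\<Sum>m\<in>insert 0 (Poly_Mapping.keys p). Poly_Mapping.lookup p m * (if m = 0 then 1 else 0))"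
    by (subst evaluate_eq_sum[of "insert 0 (Poly_Mapping.keys p)"]) auto
  thus ?thesis
    by (simp add: if_distrib sum.delta cong: if_cong)
qed

lemma evaluate_homogeneous:
  assumes "homogeneous (int n) p"
  shows "evaluate p (\<lambda>i. t * v i) = t ^ n * evaluate p v"
  unfolding evaluate_def sum_distrib_left
proof (intro sum.cong refl)
  fix m assume m: "m \<in> Poly_Mapping.keys p"
  have "(\<Sum>i\<in>UNIV. int (Poly_Mapping.lookup m i)) = int n"
    using assms m by (auto simp: homogeneous_def)
  hence "(\<Sum>i\<in>UNIV. Poly_Mapping.lookup m i) = n"
    by (metis of_nat_eq_iff of_nat_sum)
  hence "(\<Prod>i\<in>UNIV. t ^ Poly_Mapping.lookup m i) = t ^ n"
    by (simp flip: power_sum)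
  thus "Poly_Mapping.lookup p m * (\<Prod>i\<in>UNIV. (t * v i) ^ Poly_Mapping.lookup m i) =
      t ^ n * (Poly_Mapping.lookup p m * (\<Prod>i\<in>UNIV. v i ^ Poly_Mapping.lookup m i))"
    by (simp add: power_mult_distrib prod.distrib)
qed

lemma homogeneous_partial_deriv:
  assumes "homogeneous n p"
  shows "homogeneous (n - 1) (partial_deriv i p)"
  unfolding homogeneous_def
proof
  fix k assume "k \<in> Poly_Mapping.keys (partial_deriv i p)"
  then obtain m where m: "m \<in> Poly_Mapping.keys p"
    and k: "k \<in> Poly_Mapping.keys (Poly_Mapping.single (m - Poly_Mapping.single i 1)
          (of_nat (Poly_Mapping.lookup m i) * Poly_Mapping.lookup p m))"
    unfolding partial_deriv_def using keys_sum by fastforce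
  have k_eq: "k = m - Poly_Mapping.single i 1" and "Poly_Mapping.lookup m i \<noteq> 0"
    using k by (auto split: if_splits)
  hence "int (Poly_Mapping.lookup k j) =
      int (Poly_Mapping.lookup m j) - (if j = i then 1 else 0)" for j
    by (auto simp: Poly_Mapping.lookup_minus Poly_Mapping.lookup_single when_def)
  hence "(\<Sum>j\<in>UNIV. int (Poly_Mapping.lookup k j)) =
      (\<Sum>j\<in>UNIV. int (Poly_Mapping.lookup m j)) - 1"
    by (simp add: sum_subtractf)
  thus "(\<Sum>j\<in>UNIV. int (Poly_Mapping.lookup k j)) = n - 1"
    using assms m by (simp add: homogeneous_def)
qed

text \<open>Kronecker substitution: for \<open>N\<close> larger than all exponents, the monomials of \<open>p\<close> are sent to
  distinct powers of \<open>t\<close> by \<open>(x, y, z) \<mapsto> (t, t\<^sup>N, t\<^sup>N\<^sup>*\<^sup>N)\<close>.\<close>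

lemma evaluate_not_identically_0:
  assumes "p \<noteq> 0"
  shows "\<exists>v. evaluate p v \<noteq> 0"
proof (rule ccontr)
  assume neg: "\<nexists>v. evaluate p v \<noteq> 0"
  define K where "K = Poly_Mapping.keys p"
  have "finite (\<Union>m\<in>K. range (Poly_Mapping.lookup m))"
    unfolding K_def by (auto intro!: finite_imageI)
  then obtain N where N: "x < N" if "x \<in> (\<Union>m\<in>K. range (Poly_Mapping.lookup m))" for x
    by (meson finite_nat_set_iff_bounded)
  define c :: "monom3 \<Rightarrow> nat" where
    "c m = Poly_Mapping.lookup m 0 + N * (Poly_Mapping.lookup m 1 + N * Poly_Mapping.lookup m 2)" for m
  have inj: "inj_on c K"
  proof (rule inj_onI)
    fix m n assume mn: "m \<in> K" "n \<in> K" "c m = c n"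
    have lt: "Poly_Mapping.lookup m i < N" "Poly_Mapping.lookup n i < N" for i
      using mn N by blast+
    have e: "a = a' \<and> b = b'" if "a + N * b = a' + N * b'" "a < N" "a' < N" for a a' b b' :: nat
    proof -
      have "(a + N * b) mod N = a" "(a' + N * b') mod N = a'" "0 < N"
        using that(2,3) by simp_all
      with that have "a = a'" by metis
      thus ?thesis using that by simp
    qed
    have 0: "Poly_Mapping.lookup m 0 = Poly_Mapping.lookup n 0"
      and r: "Poly_Mapping.lookup m 1 + N * Poly_Mapping.lookup m 2 =
        Poly_Mapping.lookup n 1 + N * Poly_Mapping.lookup n 2"
      using e[OF mn(3)[unfolded c_def] lt] by auto
    \<comment> \<open>\<open>exhaust_3\<close> lists the elements as 1, 2, 3, and in the type
      \<open>3\<close> the numeral 3 is 0.\<close>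
    have "(3::3) = 0" by simp
    hence "i = 0 \<or> i = 1 \<or> i = 2" for i :: 3
      using exhaust_3[of i] by metis
    hence "Poly_Mapping.lookup m i = Poly_Mapping.lookup n i" for i
      using 0 e[OF r lt] by metis
    thus "m = n" by (rule poly_mapping_eqI)
  qed
  define q where "q = (\<Sum>m\<in>K. Polynomial.monom (Poly_Mapping.lookup p m) (c m))"
  have "poly q t = evaluate p (\<lambda>i. if i = 0 then t else if i = 1 then t ^ N else t ^ (N * N))" for t
  proof -
    have "t ^ c m = (\<Prod>i\<in>UNIV. (if i = 0 then t else if i = 1 then t ^ N else t ^ (N * N)) ^
        Poly_Mapping.lookup m i)" for m :: monom3
    proof -
      have "(3::3) = 0" by simp
      hence U: "(UNIV :: 3 set) = {0, 1, 2}"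
        using UNIV_3 by auto
      show ?thesis
        unfolding c_def U by (simp add: power_add distrib_left flip: power_mult) (simp add: mult_ac)
    qed
    thus ?thesis
      by (simp add: q_def evaluate_def K_def poly_sum poly_monom)
  qed
  hence "poly q t = 0" for t
    using neg by simp
  hence "q = 0"
    using poly_all_0_iff_0 by blast
  obtain m where m: "m \<in> K"
    using assms unfolding K_def by fastforce
  have "Polynomial.coeff q (c m) = (\<Sum>n\<in>K. if n = m then Poly_Mapping.lookup p n else 0)"
    unfolding q_def Polynomial.coeff_sum using inj m
    by (intro sum.cong refl) (auto dest: inj_onD)
  also have "\<dots> = Poly_Mapping.lookup p m"
    using m by (simp add: K_def)
  finally show False
    using \<open>q = 0\<close> m by (simp add: K_def Poly_Mapping.in_keys_iff)
qed

lemma evaluate_linear: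
  assumes "homogeneous 1 l"
  shows "evaluate l v = (\<Sum>i\<in>UNIV. Poly_Mapping.lookup l (Poly_Mapping.single i 1) * v i)"
proof -
  have sub: "Poly_Mapping.keys l \<subseteq> range (\<lambda>i. Poly_Mapping.single i (1::nat))"
  proof
    fix m assume "m \<in> Poly_Mapping.keys l"
    hence "(\<Sum>i\<in>UNIV. int (Poly_Mapping.lookup m i)) = 1"
      using assms by (simp add: homogeneous_def)
    hence s: "(\<Sum>i\<in>UNIV. Poly_Mapping.lookup m i) = 1"
      by (metis of_nat_1_eq_iff of_nat_sum)
    then obtain i where i: "Poly_Mapping.lookup m i = 1" "\<And>j. j \<noteq> i \<Longrightarrow> Poly_Mapping.lookup m j = 0"
      using sum_eq_1_iff[of UNIV "Poly_Mapping.lookup m"] by auto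
    hence "m = Poly_Mapping.single i 1"
      by (intro poly_mapping_eqI) (auto simp: Poly_Mapping.lookup_single when_def)
    thus "m \<in> range (\<lambda>i. Poly_Mapping.single i (1::nat))" by blast
  qed
  have inj: "inj (\<lambda>i::3. Poly_Mapping.single i (1::nat))"
    by (metis (no_types, lifting) injI lookup_single_eq lookup_single_not_eq zero_neq_one)
  have pr: "(\<Prod>j\<in>UNIV. v j ^ Poly_Mapping.lookup (Poly_Mapping.single i (1::nat)) j) = v i" for i
    by (simp add: Poly_Mapping.lookup_single when_def prod.delta if_distrib[of "\<lambda>n. _ ^ n"] cong: if_cong)
  show ?thesis
    by (subst evaluate_eq_sum[OF _ sub]) (simp_all add: sum.reindex[OF inj] pr del: One_nat_def)
qed

lemma continuous_on_evaluate [continuous_intros]: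
  "(\<And>i. continuous_on A (\<lambda>x. g x i)) \<Longrightarrow> continuous_on A (\<lambda>x. evaluate p (g x))"
  unfolding evaluate_def by (intro continuous_intros)

lemma has_derivative_evaluate:
  fixes v :: "complex^3"
  shows "((\<lambda>v. evaluate p (vec_nth v)) has_derivative
    (\<lambda>h. \<Sum>i\<in>UNIV. evaluate (partial_deriv i p) (vec_nth v) * h $ i)) (at v)"
proof -
  \<comment> \<open>Splitting off the factor of the variable \<open>i\<close> gives the shape in
    which the product rule below delivers the derivative of a monomial.\<close>
  have pd: "evaluate (partial_deriv i p) w = (\<Sum>m\<in>Poly_Mapping.keys p. Poly_Mapping.lookup p m *
      (of_nat (Poly_Mapping.lookup m i) * w i ^ (Poly_Mapping.lookup m i - 1) *
        (\<Prod>j\<in>UNIV - {i}. w j ^ Poly_Mapping.lookup m j)))" for i w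
  proof -
    have "(\<Prod>j\<in>UNIV. w j ^ Poly_Mapping.lookup (m - Poly_Mapping.single i 1) j) =
        w i ^ (Poly_Mapping.lookup m i - 1) * (\<Prod>j\<in>UNIV - {i}. w j ^ Poly_Mapping.lookup m j)" for m
    proof -
      have "(\<Prod>j\<in>UNIV - {i}. w j ^ Poly_Mapping.lookup (m - Poly_Mapping.single i 1) j) =
          (\<Prod>j\<in>UNIV - {i}. w j ^ Poly_Mapping.lookup m j)"
        by (intro prod.cong) (auto simp: Poly_Mapping.lookup_minus Poly_Mapping.lookup_single when_def)
      thus ?thesis
        by (subst prod.remove[of UNIV i]) (auto simp: Poly_Mapping.lookup_minus Poly_Mapping.lookup_single)
    qed
    thus ?thesis
      unfolding partial_deriv_def by (simp add: mult_ac del: One_nat_def)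
  qed
  have "((\<lambda>v::complex^3. \<Prod>i\<in>UNIV. v $ i ^ Poly_Mapping.lookup m i) has_derivative
     (\<lambda>h. \<Sum>i\<in>UNIV. (of_nat (Poly_Mapping.lookup m i) * (h $ i) * v $ i ^ (Poly_Mapping.lookup m i - 1)) *
        (\<Prod>j\<in>UNIV - {i}. v $ j ^ Poly_Mapping.lookup m j))) (at v)" for m :: monom3
    by (rule has_derivative_prod) (auto intro!: derivative_eq_intros bounded_linear.has_derivative[OF bounded_linear_vec_nth] simp: mult_ac)
  hence "((\<lambda>v::complex^3. evaluate p (vec_nth v)) has_derivative
     (\<lambda>h. \<Sum>m\<in>Poly_Mapping.keys p. Poly_Mapping.lookup p m * (\<Sum>i\<in>UNIV. (of_nat (Poly_Mapping.lookup m i) * (h $ i) * v $ i ^ (Poly_Mapping.lookup m i - 1)) *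
        (\<Prod>j\<in>UNIV - {i}. v $ j ^ Poly_Mapping.lookup m j)))) (at v)"
    unfolding evaluate_def by (intro has_derivative_sum has_derivative_mult_right)
  also have "(\<lambda>h. \<Sum>m\<in>Poly_Mapping.keys p. Poly_Mapping.lookup p m * (\<Sum>i\<in>UNIV. (of_nat (Poly_Mapping.lookup m i) * (h $ i) * v $ i ^ (Poly_Mapping.lookup m i - 1)) *
        (\<Prod>j\<in>UNIV - {i}. v $ j ^ Poly_Mapping.lookup m j)))
     = (\<lambda>h. \<Sum>i\<in>UNIV. evaluate (partial_deriv i p) (vec_nth v) * h $ i)"
    unfolding pd sum_distrib_left sum_distrib_right
    by (subst sum.swap) (simp add: mult_ac)
  finally show ?thesis .
qed

text \<open>The function t \<mapsto> p(t v) is differentiated at t = 1 in two ways: by the chain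
  rule, and as t^n p(v).\<close>

lemma euler_identity:
  fixes v :: "complex^3"
  assumes "homogeneous (int n) p"
  shows "(\<Sum>i\<in>UNIV. evaluate (partial_deriv i p) (vec_nth v) * v $ i) = of_nat n * evaluate p (vec_nth v)"
proof -
  have "linear (\<lambda>h. h *s v)"
    by (rule linearI) (simp_all add: vec_eq_iff algebra_simps)
  hence "bounded_linear (\<lambda>h. h *s v)"
    by (simp add: linear_conv_bounded_linear)
  hence 0: "((\<lambda>h. h *s v) has_derivative (\<lambda>h. h *s v)) (at 1)"
    by (rule bounded_linear_imp_has_derivative)
  have 1: "((\<lambda>t::complex. evaluate p (vec_nth (t *s v))) has_derivative
     (\<lambda>h. \<Sum>i\<in>UNIV. evaluate (partial_deriv i p) (vec_nth (1 *s v)) * (h *s v) $ i)) (at 1)"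
    by (rule has_derivative_compose[OF 0 has_derivative_evaluate])
  have 2: "((\<lambda>t::complex. t ^ n * evaluate p (vec_nth v)) has_derivative
     (\<lambda>h. of_nat n * h * evaluate p (vec_nth v))) (at 1)"
    by (auto intro!: derivative_eq_intros)
  have "evaluate p (vec_nth (t *s v)) = t ^ n * evaluate p (vec_nth v)" for t
    using evaluate_homogeneous[OF assms, of t "vec_nth v"] by (simp add: vector_scalar_mult_def vec_lambda_inverse)
  with has_derivative_unique[OF 1, of "\<lambda>h. of_nat n * h * evaluate p (vec_nth v)"] 2
  have "(\<lambda>h. \<Sum>i\<in>UNIV. evaluate (partial_deriv i p) (vec_nth (1 *s v)) * (h *s v) $ i) =
     (\<lambda>h. of_nat n * h * evaluate p (vec_nth v))"
    by simp
  from fun_cong[OF this, of 1] show ?thesis by simp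
qed

section \<open>Integration by parts for compactly supported functions\<close>

lemma lborel_integral_translation:
  fixes f :: "'a::euclidean_space \<Rightarrow> 'b::{banach, second_countable_topology}"
  shows "integral\<^sup>L lborel (\<lambda>x. f (x + a)) = integral\<^sup>L lborel f"
proof (cases "f \<in> borel_measurable borel")
  case True
  have "integral\<^sup>L lborel f = integral\<^sup>L (distr lborel borel ((+) a)) f"
    by (simp add: lborel_distr_plus)
  also have "\<dots> = integral\<^sup>L lborel (\<lambda>x. f (a + x))"
    using True by (subst integral_distr) auto
  finally show ?thesis by (simp add: add.commute)
next
  \<comment> \<open>A non-measurable function is not integrable, so both integrals have the default
    value 0.\<close>
  case False
  have "(\<lambda>x. f (x + a)) \<notin> borel_measurable lborel"
  proof
    assume "(\<lambda>x. f (x + a)) \<in> borel_measurable lborel"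
    hence "(\<lambda>x. f (x + a)) \<in> borel_measurable borel" by simp
    from measurable_compose[OF _ this, of "\<lambda>x. x - a" borel] show False
      using False by simp
  qed
  with False show ?thesis
    by (simp add: not_integrable_integral_eq borel_measurable_integrable
        integrable_iff_bounded)
qed

lemma nn_integral_lborel_translation:
  fixes f :: "'a::euclidean_space \<Rightarrow> ennreal"
  assumes [measurable]: "f \<in> borel_measurable borel"
  shows "(\<integral>\<^sup>+x. f (x + a) \<partial>lborel) = integral\<^sup>N lborel f"
proof -
  have "integral\<^sup>N lborel f = integral\<^sup>N (distr lborel borel ((+) a)) f"
    by (simp add: lborel_distr_plus)
  also have "\<dots> = (\<integral>\<^sup>+x. f (a + x) \<partial>lborel)"
    by (subst nn_integral_distr) auto
  finally show ?thesis by (simp add: add.commute)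
qed

lemma integrable_continuous_compact_support:
  fixes f :: "'a::euclidean_space \<Rightarrow> 'b::euclidean_space"
  assumes "continuous_on UNIV f" and "compact K" and "\<And>x. x \<notin> K \<Longrightarrow> f x = 0"
  shows "integrable lborel f"
proof -
  have "integrable lborel (\<lambda>x. indicator K x *\<^sub>R f x)"
    using assms(1,2) by (intro borel_integrable_compact) (auto intro: continuous_on_subset)
  moreover have "(\<lambda>x. indicator K x *\<^sub>R f x) = f"
    using assms(3) by (auto simp: indicator_def)
  ultimately show ?thesis by simp
qed

text \<open>By translation invariance every difference quotient of \<open>G\<close> has integral
  zero. The quotients are bounded by the mean value inequality and live in one fixed ball, so
  dominated convergence carries this to the derivative; no iterated integral along \<open>e\<close>
  is needed.\<close>

lemma integral_directional_derivative_eq_0: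
  fixes G :: "'a::euclidean_space \<Rightarrow> 'b::euclidean_space"
  assumes der: "\<And>v. (G has_derivative G' v) (at v)"
    and cont: "continuous_on UNIV (\<lambda>v. G' v e)"
    and supp: "\<And>v. norm v \<ge> R \<Longrightarrow> G v = 0"
  shows "integrable lborel (\<lambda>v. G' v e)" and "(LBINT v. G' v e) = 0"
proof -
  have lin: "linear (G' v)" for v
    using der by (rule has_derivative_linear)
  \<comment> \<open>The inequality is strict so that \<open>G\<close> vanishes on a whole
    neighbourhood of \<open>v\<close>.\<close>
  have supp': "G' v e = 0" if "norm v > R" for v
  proof -
    have "(G has_derivative (\<lambda>_. 0)) (at v)"
    proof (rule has_derivative_transform_within_open[of "\<lambda>_. 0"])
      show "open {x. norm x > R}" by (intro open_Collect_less continuous_intros)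
    qed (use that supp in auto)
    thus ?thesis using has_derivative_unique[OF der] by metis
  qed
  show int: "integrable lborel (\<lambda>v. G' v e)"
    by (rule integrable_continuous_compact_support[OF cont compact_cball[of 0 R]]) (simp add: supp')
  have "bounded (range (\<lambda>v. G' v e))"
  proof -
    have "bounded ((\<lambda>v. G' v e) ` cball 0 R)"
      by (intro compact_imp_bounded compact_continuous_image continuous_on_subset[OF cont]) auto
    moreover have "range (\<lambda>v. G' v e) \<subseteq> insert 0 ((\<lambda>v. G' v e) ` cball 0 R)"
    proof (intro image_subsetI)
      fix v show "G' v e \<in> insert 0 ((\<lambda>v. G' v e) ` cball 0 R)"
        using supp'[of v] by (cases "norm v > R") auto
    qed
    ultimately show ?thesis by (meson bounded_insert bounded_subset)
  qed
  then obtain M where M: "norm (G' v e) \<le> M" for v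
    unfolding bounded_iff by blast
  define t :: "nat \<Rightarrow> real" where "t n = inverse (Suc n)" for n
  have t: "0 < t n" "t n \<le> 1" for n
    by (auto simp: t_def field_simps)
  define Q where "Q n v = inverse (t n) *\<^sub>R (G (v + t n *\<^sub>R e) - G v)" for n v
  have Gc: "continuous_on UNIV G"
    using der by (meson continuous_at_imp_continuous_on has_derivative_continuous)
  have Gint: "integrable lborel G"
    by (rule integrable_continuous_compact_support[OF Gc compact_cball[of 0 R]]) (simp add: supp)
  have Gint': "integrable lborel (\<lambda>v. G (v + a))" for a
    by (rule integrable_continuous_compact_support[OF _ compact_cball[of "-a" R]])
       (auto intro!: continuous_on_compose2[OF Gc] continuous_intros supp simp: dist_norm norm_minus_commute add.commute)
  have Q0: "(LBINT v. Q n v) = 0" for n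
    unfolding Q_def using Gint Gint' by (simp add: lborel_integral_translation)
  have bound: "norm (Q n v) \<le> M" for n v
  proof -
    have "norm (G (v + t n *\<^sub>R e) - G v) \<le> M * t n"
    proof -
      have "((\<lambda>x. G (v + x *\<^sub>R e)) has_vector_derivative G' (v + x *\<^sub>R e) e) (at x)" for x
        unfolding has_vector_derivative_def
      proof (rule has_derivative_eq_rhs)
        show "((\<lambda>x. G (v + x *\<^sub>R e)) has_derivative (\<lambda>h. G' (v + x *\<^sub>R e) (h *\<^sub>R e))) (at x)"
          by (rule has_derivative_compose[OF _ der]) (auto intro!: derivative_eq_intros)
        show "(\<lambda>h. G' (v + x *\<^sub>R e) (h *\<^sub>R e)) = (\<lambda>h. h *\<^sub>R G' (v + x *\<^sub>R e) e)"
          using lin by (simp add: linear_scale)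
      qed
      hence "norm (G (v + t n *\<^sub>R e) - G (v + 0 *\<^sub>R e)) \<le> M * norm (t n - 0)"
        by (intro differentiable_bound[of UNIV _ "\<lambda>x h. h *\<^sub>R G' (v + x *\<^sub>R e) e"])
           (auto simp: has_vector_derivative_def mult.commute[of M] intro!: onorm_le mult_left_mono M)
      thus ?thesis using t[of n] by simp
    qed
    hence "inverse (t n) * norm (G (v + t n *\<^sub>R e) - G v) \<le> inverse (t n) * (M * t n)"
      using t[of n] by (intro mult_left_mono) auto
    also have "\<dots> = M" using t(1)[of n] by (simp add: field_simps)
    finally show ?thesis using t[of n] by (simp add: Q_def)
  qed
  have Qsupp: "Q n v = 0" if "v \<notin> cball 0 (R + norm e)" for n v
  proof -
    have "norm v \<ge> R + norm e" using that by simp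
    moreover have "norm (t n *\<^sub>R e) \<le> norm e" using t[of n] by (simp add: mult_left_le_one_le)
    moreover have "norm v \<le> norm (v + t n *\<^sub>R e) + norm (t n *\<^sub>R e)"
      using norm_triangle_sub[of v "v + t n *\<^sub>R e"] by simp
    ultimately have "G (v + t n *\<^sub>R e) = 0" "G v = 0"
      using norm_ge_zero[of e] by (intro supp; linarith)+
    thus ?thesis by (simp add: Q_def)
  qed
  have "(\<lambda>n. LBINT v. Q n v) \<longlonglongrightarrow> (LBINT v. G' v e)"
  proof (rule integral_dominated_convergence[where w = "\<lambda>v. indicator (cball 0 (R + norm e)) v *\<^sub>R M"])
    show "(\<lambda>v. G' v e) \<in> borel_measurable lborel"
      using int by (rule borel_measurable_integrable)
    show "Q n \<in> borel_measurable lborel" for n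
      unfolding Q_def using Gint Gint' by (intro borel_measurable_scaleR borel_measurable_diff) auto
    show "integrable lborel (\<lambda>v. indicator (cball 0 (R + norm e)) v *\<^sub>R M)"
      using emeasure_lborel_cball_finite[of 0 "R + norm e"] by (intro integrable_scaleR_left) auto
    show "AE v in lborel. norm (Q n v) \<le> indicator (cball 0 (R + norm e)) v *\<^sub>R M" for n
      using bound Qsupp[of _ n] by (auto simp: indicator_def)
    show "AE v in lborel. (\<lambda>n. Q n v) \<longlonglongrightarrow> G' v e"
    proof (intro AE_I2)
      fix v
      have "((\<lambda>x. G (v + x *\<^sub>R e)) has_derivative (\<lambda>h. G' (v + 0 *\<^sub>R e) (h *\<^sub>R e))) (at 0)"
        by (rule has_derivative_compose[OF _ der]) (auto intro!: derivative_eq_intros)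
      hence "((\<lambda>x. G (v + x *\<^sub>R e)) has_vector_derivative G' v e) (at 0)"
        using lin by (simp add: has_vector_derivative_def linear_scale)
      hence "((\<lambda>h. norm (G (v + h *\<^sub>R e) - G v - h *\<^sub>R G' v e) / norm h) \<longlongrightarrow> 0) (at 0)"
        by (simp add: has_vector_derivative_def has_derivative_at)
      moreover have "norm (G (v + h *\<^sub>R e) - G v - h *\<^sub>R G' v e) / norm h =
          norm ((G (v + h *\<^sub>R e) - G v) /\<^sub>R h - G' v e)" if "h \<noteq> 0" for h
      proof -
        have "(G (v + h *\<^sub>R e) - G v) /\<^sub>R h - G' v e = (G (v + h *\<^sub>R e) - G v - h *\<^sub>R G' v e) /\<^sub>R h"
          using that by (simp add: scaleR_diff_right)
        thus ?thesis by (simp add: divide_inverse mult.commute)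
      qed
      hence "eventually (\<lambda>h. norm (G (v + h *\<^sub>R e) - G v - h *\<^sub>R G' v e) / norm h =
          norm ((G (v + h *\<^sub>R e) - G v) /\<^sub>R h - G' v e)) (at 0)"
        by (auto simp: eventually_at_filter)
      ultimately have "((\<lambda>h. norm ((G (v + h *\<^sub>R e) - G v) /\<^sub>R h - G' v e)) \<longlongrightarrow> 0) (at 0)"
        by (rule Lim_transform_eventually)
      hence lim: "((\<lambda>x. (G (v + x *\<^sub>R e) - G v) /\<^sub>R x) \<longlongrightarrow> G' v e) (at 0)"
        by (rule LIM_zero_cancel[OF tendsto_norm_zero_cancel])
      have "filterlim t (at 0) sequentially"
        unfolding filterlim_at using t LIMSEQ_inverse_real_of_nat
        by (auto simp: t_def[abs_def])
      from filterlim_compose[OF lim this] show "(\<lambda>n. Q n v) \<longlonglongrightarrow> G' v e"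
        by (simp add: Q_def o_def)
    qed
  qed
  thus "(LBINT v. G' v e) = 0"
    unfolding Q0 by (simp add: LIMSEQ_const_iff)
qed

section \<open>Integrability of negative powers of linear forms\<close>

lemma cball_in_sets_borel [measurable]: "cball a R \<in> sets borel"
  by simp

text \<open>On the dyadic annulus (1/2)^(n+1) < |u| \<le> (1/2)^n the integrand is at most
  \<open>c n\<close>, and the disc \<open>B n\<close> has area \<pi> 4^(-n). The integral is thus
  bounded by a geometric series of ratio 2^(b - 2). The term \<open>max b 0\<close> also covers
  negative \<open>b\<close>, where 1 is a bound.\<close>

lemma nn_integral_unit_disc_powr:
  fixes b :: real
  assumes "b < 2"
  shows "(\<integral>\<^sup>+u\<in>cball 0 1. ennreal (cmod u powr - b) \<partial>lborel) < \<infinity>"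
proof -
  define c where "c n = 2 powr (max b 0 * (real n + 1))" for n
  define B where "B n = cball (0::complex) ((1/2) ^ n)" for n
  have "ennreal (cmod u powr - b) * indicator (cball 0 1) u \<le> suminf (\<lambda>n. ennreal (c n) * indicator (B n) u)"
    for u :: complex
  \<comment> \<open>At the origin the integrand is 0, by the convention
    \<open>0 powr x = 0\<close>.\<close>
  proof (cases "u \<noteq> 0 \<and> cmod u \<le> 1")
    case True
    define n where "n = (LEAST n. (1/2) ^ Suc n < cmod u)"
    have "\<exists>n. (1/2) ^ Suc n < cmod u"
    proof -
      obtain n where "(1/2) ^ n < cmod u"
        using real_arch_pow_inv[of "cmod u" "1/2"] True by auto
      moreover have "(1/2::real) ^ Suc n \<le> (1/2) ^ n" by simp
      ultimately show ?thesis by (meson le_less_trans)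
    qed
    hence n: "(1/2) ^ Suc n < cmod u"
      unfolding n_def by (rule LeastI_ex)
    have "cmod u \<le> (1/2) ^ n"
    proof (cases n)
      case (Suc m)
      have "\<not> (1/2) ^ Suc m < cmod u"
        using not_less_Least[of m "\<lambda>n. (1/2) ^ Suc n < cmod u"] Suc unfolding n_def by simp
      thus ?thesis using Suc by simp
    qed (use True in auto)
    hence "u \<in> B n" by (simp add: B_def)
    have "cmod u powr - b \<le> c n"
    proof (cases "b \<ge> 0")
      case True
      have "cmod u powr - b \<le> ((1/2) ^ Suc n) powr - b"
        using n True by (intro powr_mono2') auto
      also have "(1/2::real) ^ Suc n = inverse (2 powr real (Suc n))"
        by (subst powr_realpow) (simp_all add: power_one_over inverse_eq_divide)
      also have "\<dots> = 2 powr - real (Suc n)"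
        by (rule powr_minus[symmetric])
      also have "\<dots> powr - b = c n"
      proof -
        have "- real (Suc n) * - b = max b 0 * (real n + 1)"
          using True by (simp add: algebra_simps)
        thus ?thesis unfolding c_def powr_powr by simp
      qed
      finally show ?thesis .
    next
      case False
      with True have "cmod u powr - b \<le> 1" by (intro powr_le1) auto
      with False show ?thesis by (simp add: c_def)
    qed
    hence "ennreal (cmod u powr - b) * indicator (cball 0 1) u \<le> ennreal (c n) * indicator (B n) u"
      using True \<open>u \<in> B n\<close> by (simp add: ennreal_leI)
    also have "\<dots> \<le> suminf (\<lambda>n. ennreal (c n) * indicator (B n) u)"
    proof -
      define F where "F m = ennreal (c m) * indicator (B m) u" for m
      have "F n = sum F {n}" by simp
      also have "\<dots> \<le> suminf (\<lambda>m. F m)" by (rule sum_le_suminf) auto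
      finally show ?thesis unfolding F_def .
    qed
    finally show ?thesis .
  qed (auto simp: indicator_def)
  hence "(\<integral>\<^sup>+u\<in>cball 0 1. ennreal (cmod u powr - b) \<partial>lborel) \<le>
      (\<integral>\<^sup>+u. suminf (\<lambda>n. ennreal (c n) * indicator (B n) u) \<partial>lborel)"
    by (intro nn_integral_mono) auto
  also have "\<dots> = suminf (\<lambda>n. ennreal (c n) * emeasure lborel (B n))"
    by (subst nn_integral_suminf) (auto simp: B_def nn_integral_cmult_indicator)
  also have "\<dots> = suminf (\<lambda>n. ennreal (2 powr max b 0 * pi * (2 powr (max b 0 - 2)) ^ n))"
  proof (intro suminf_cong)
    fix n
    have "c n * (pi * ((1/2) ^ n)\<^sup>2) = 2 powr max b 0 * pi * (2 powr (max b 0 - 2)) ^ n"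
    proof -
      have "c n = 2 powr max b 0 * (2 powr max b 0) ^ n"
        by (simp add: c_def distrib_left powr_add powr_powr flip: powr_realpow)
      moreover have "((1/2::real) ^ n)\<^sup>2 = ((1/2)\<^sup>2) ^ n"
        by (metis power_mult mult.commute)
      moreover have "(1/2::real)\<^sup>2 = 1/4"
        by (simp add: power2_eq_square)
      moreover have "2 powr (max b 0 - 2) = 2 powr max b 0 * (1/4::real)"
        by (simp add: powr_diff)
      hence "(2 powr (max b 0 - 2)) ^ n = (2 powr max b 0) ^ n * (1/4::real) ^ n"
        by (simp only: power_mult_distrib)
      ultimately show ?thesis by (simp only: mult_ac)
    qed
    thus "ennreal (c n) * emeasure lborel (B n) =
        ennreal (2 powr max b 0 * pi * (2 powr (max b 0 - 2)) ^ n)"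
      by (simp add: B_def emeasure_cball unit_ball_vol_2 c_def flip: ennreal_mult)
  qed
  also have "\<dots> < \<infinity>"
  proof -
    have "2 powr (max b 0 - 2) < (1::real)"
      using assms by (simp add: powr_less_one)
    hence "summable (\<lambda>n. 2 powr max b 0 * pi * (2 powr (max b 0 - 2)) ^ n)"
      by (intro summable_mult summable_geometric) simp
    thus ?thesis by (subst suminf_ennreal2) auto
  qed
  finally show ?thesis .
qed

text \<open>Where |c + t| \<le> 1 the integral is at most the centred one, and elsewhere the
  integrand is at most 1. What matters is that \<open>M\<close> does not depend on the
  centre.\<close>

lemma nn_integral_translated_disc_powr:
  fixes b :: real
  assumes "0 \<le> b" "b < 2"
  obtains M where "M < \<infinity>" and
    "\<And>c. (\<integral>\<^sup>+t\<in>cball 0 1. ennreal (cmod (c + t) powr - b) \<partial>lborel) \<le> M"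
proof
  let ?M = "(\<integral>\<^sup>+u\<in>cball 0 1. ennreal (cmod u powr - b) \<partial>lborel) + emeasure lborel (cball (0::complex) 1)"
  show "?M < \<infinity>"
    using nn_integral_unit_disc_powr[OF assms(2)] emeasure_lborel_cball_finite[of "0::complex" 1] by simp
  fix c
  have "ennreal (cmod (c + t) powr - b) * indicator (cball 0 1) t \<le>
      ennreal (cmod (t + c) powr - b) * indicator (cball 0 1) (t + c) + indicator (cball 0 1) t" for t
  proof (cases "cmod (c + t) \<le> 1")
    case False
    hence "cmod (c + t) powr - b \<le> 1 powr - b"
      using assms by (intro powr_mono2') auto
    thus ?thesis using False by (auto simp: indicator_def add.commute)
  qed (auto simp: indicator_def add.commute)
  hence "(\<integral>\<^sup>+t\<in>cball 0 1. ennreal (cmod (c + t) powr - b) \<partial>lborel) \<le>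
      (\<integral>\<^sup>+t. ennreal (cmod (t + c) powr - b) * indicator (cball 0 1) (t + c) + indicator (cball 0 1) t \<partial>lborel)"
    by (intro nn_integral_mono) auto
  also have "\<dots> = (\<integral>\<^sup>+t. ennreal (cmod (t + c) powr - b) * indicator (cball 0 1) (t + c) \<partial>lborel)
      + emeasure lborel (cball (0::complex) 1)"
    by (subst nn_integral_add) simp_all
  also have "\<dots> = ?M"
    by (subst nn_integral_lborel_translation[of "\<lambda>t. ennreal (cmod t powr - b) * indicator (cball 0 1) t"]) simp_all
  finally show "(\<integral>\<^sup>+t\<in>cball 0 1. ennreal (cmod (c + t) powr - b) \<partial>lborel) \<le> ?M" .
qed

lemma vector_smult_measurable [measurable]:
  "(\<lambda>t. t *s e) \<in> borel_measurable (borel :: complex measure)" for e :: "complex^'n"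
proof (rule borel_measurable_continuous_onI)
  have "continuous_on UNIV (\<lambda>t. \<chi> i. t * e $ i)" 
    by (intro continuous_intros)
  thus "continuous_on UNIV (\<lambda>t. t *s e)"
    by (simp add: vector_scalar_mult_def)
qed

lemma norm_smult: "norm (t *s e) = cmod t * norm e" for e :: "complex^'n"
  by (simp add: norm_vec_def L2_set_def norm_mult power_mult_distrib real_sqrt_mult flip: sum_distrib_left)

text \<open>Averaging over the translates by \<open>t *s e\<close> with \<open>t\<close> in the unit disc replaces a change of
  coordinates.\<close>

lemma nn_integral_average:
  fixes F :: "complex^'n \<Rightarrow> ennreal"
  assumes [measurable]: "F \<in> borel_measurable borel"
  shows "(\<integral>\<^sup>+v. (\<integral>\<^sup>+t\<in>cball 0 1. F (v + t *s e) \<partial>lborel) \<partial>lborel) = ennreal pi * integral\<^sup>N lborel F"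
proof -
  have "(\<integral>\<^sup>+v. (\<integral>\<^sup>+t\<in>cball 0 1. F (v + t *s e) \<partial>lborel) \<partial>lborel) =
      (\<integral>\<^sup>+t. (\<integral>\<^sup>+v. F (v + t *s e) * indicator (cball 0 1) t \<partial>lborel) \<partial>lborel)"
    by (rule lborel_pair.Fubini') measurable
  also have "\<dots> = (\<integral>\<^sup>+t. integral\<^sup>N lborel F * indicator (cball 0 1) t \<partial>(lborel :: complex measure))"
    by (simp add: nn_integral_multc nn_integral_lborel_translation)
  also have "\<dots> = ennreal pi * integral\<^sup>N lborel F"
    by (simp add: nn_integral_cmult_indicator emeasure_cball unit_ball_vol_2 mult.commute)
  finally show ?thesis .
qed

text \<open>Along \<open>e\<close> the function \<open>\<alpha>\<close> moves with unit speed while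
  \<open>h\<close> stays constant, so the average over the disc only sees a translated one-variable
  integral, bounded uniformly by \<open>M\<close>. This integrates out one linear form at a
  time.\<close>

lemma nn_integral_power_of_form_step:
  fixes e :: "complex^'n" and b :: real
  assumes b: "0 \<le> b" "b < 2"
    and [measurable]: "\<alpha> \<in> borel_measurable borel" "h \<in> borel_measurable borel"
    and \<alpha>: "\<And>v t. \<alpha> (v + t *s e) = \<alpha> v + t" and h: "\<And>v t. h (v + t *s e) = (h v :: ennreal)"
    and fin: "\<And>R. (\<integral>\<^sup>+v\<in>cball 0 R. h v \<partial>lborel) < \<infinity>"
  shows "(\<integral>\<^sup>+v\<in>cball 0 R. ennreal (cmod (\<alpha> v) powr - b) * h v \<partial>lborel) < \<infinity>"
proof -
  obtain M where M: "M < \<infinity>" "\<And>c. (\<integral>\<^sup>+t\<in>cball 0 1. ennreal (cmod (c + t) powr - b) \<partial>lborel) \<le> M"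
    using nn_integral_translated_disc_powr[OF b] by blast
  let ?F = "\<lambda>v. ennreal (cmod (\<alpha> v) powr - b) * h v * indicator (cball 0 R) v"
  \<comment> \<open>The ball grows by \<open>norm e\<close> because the translations are by
    \<open>t *s e\<close> with |t| \<le> 1.\<close>
  let ?B = "cball (0::complex^'n) (R + norm e)"
  have "ennreal pi * integral\<^sup>N lborel ?F = (\<integral>\<^sup>+v. (\<integral>\<^sup>+t\<in>cball 0 1. ?F (v + t *s e) \<partial>lborel) \<partial>lborel)"
    by (subst nn_integral_average) measurable
  also have "\<dots> \<le> (\<integral>\<^sup>+v. (\<integral>\<^sup>+t. h v * indicator ?B v *
      (ennreal (cmod (\<alpha> v + t) powr - b) * indicator (cball 0 1) t) \<partial>lborel) \<partial>lborel)"
  proof (intro nn_integral_mono)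
    fix v t
    have "norm v \<le> R + norm e" if "norm (v + t *s e) \<le> R" "cmod t \<le> 1"
    proof -
      have "norm v \<le> norm (v + t *s e) + norm (t *s e)"
        using norm_triangle_sub[of v "v + t *s e"] by simp
      moreover have "norm (t *s e) \<le> norm e"
        using that by (simp add: norm_smult mult_left_le_one_le)
      ultimately show ?thesis using that by simp
    qed
    thus "?F (v + t *s e) * indicator (cball 0 1) t \<le> h v * indicator ?B v *
      (ennreal (cmod (\<alpha> v + t) powr - b) * indicator (cball 0 1) t)"
      by (auto simp: indicator_def \<alpha> h mult_ac)
  qed
  also have "\<dots> = (\<integral>\<^sup>+v. h v * indicator ?B v *
      (\<integral>\<^sup>+t\<in>cball 0 1. ennreal (cmod (\<alpha> v + t) powr - b) \<partial>lborel) \<partial>lborel)"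
    by (subst nn_integral_cmult) auto
  also have "\<dots> \<le> (\<integral>\<^sup>+v. h v * indicator ?B v * M \<partial>lborel)"
    by (intro nn_integral_mono mult_left_mono M) auto
  also have "\<dots> = (\<integral>\<^sup>+v\<in>?B. h v \<partial>lborel) * M"
    by (rule nn_integral_multc) measurable
  also have "\<dots> < \<infinity>"
    using M fin by (simp add: ennreal_mult_less_top)
  finally show ?thesis
    by (auto simp: ennreal_mult_less_top)
qed

definition linform :: "complex^'n \<Rightarrow> complex^'n \<Rightarrow> complex" where
  "linform a v = (\<Sum>i\<in>UNIV. a $ i * v $ i)"

lemma linform_add: "linform a (v + w) = linform a v + linform a w"
  by (simp add: linform_def distrib_left sum.distrib)

lemma linform_smult: "linform a (t *s v) = t * linform a v"
  by (simp add: linform_def sum_distrib_left mult_ac)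

lemma linform_scaleR: "linform a (c *\<^sub>R v) = of_real c * linform a v"
  unfolding linform_def vector_scaleR_component
  unfolding scaleR_conv_of_real
  by (simp add: sum_distrib_left mult_ac)

lemma continuous_on_linform [continuous_intros]:
  "continuous_on A g \<Longrightarrow> continuous_on A (\<lambda>x. linform a (g x))"
  unfolding linform_def by (intro continuous_intros)

lemma linform_measurable [measurable]: "linform a \<in> borel_measurable borel"
  by (intro borel_measurable_continuous_onI continuous_intros)

text \<open>The one-form step is applied along \<open>e'\<close> with h = 1 and then along
  \<open>e\<close>, on which the second form is constant.\<close>

lemma nn_integral_two_forms:
  fixes a a' e e' :: "complex^'n"
  assumes b: "0 \<le> b" "b < 2"
    and e: "linform a e = 1" "linform a' e = 0" "linform a' e' = 1"
  shows "(\<integral>\<^sup>+v\<in>cball 0 R. ennreal (cmod (linform a v) powr - b * cmod (linform a' v) powr - b) \<partial>lborel) < \<infinity>"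
proof -
  have "(\<integral>\<^sup>+v\<in>cball 0 R. ennreal (cmod (linform a' v) powr - b) * 1 \<partial>lborel) < \<infinity>" for R
    by (rule nn_integral_power_of_form_step[of _ _ _ e'])
       (use b e emeasure_lborel_cball_finite in \<open>auto simp: linform_add linform_smult\<close>)
  hence "(\<integral>\<^sup>+v\<in>cball 0 R. ennreal (cmod (linform a v) powr - b) * ennreal (cmod (linform a' v) powr - b) \<partial>lborel) < \<infinity>"
    by (intro nn_integral_power_of_form_step[of _ _ _ e])
       (use b e in \<open>auto simp: linform_add linform_smult\<close>)
  thus ?thesis by (simp add: ennreal_mult)
qed

section \<open>Integrability of negative powers of products with at most triple zeros\<close>

text \<open>The power of the largest number is shared equally between the two others. Three
  concurrent lines are thereby reduced to two independent forms with exponent 3 s, and integrability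
  in one complex variable requires 3 s < 2: this is the source of the bound s < 2/3.\<close>

lemma powr_three_le_two:
  fixes x y z s :: real
  assumes "0 < x" "0 < y" "x \<le> z" "y \<le> z" "0 \<le> s"
  shows "x powr (-2 * s) * y powr (-2 * s) * z powr (-2 * s) \<le> x powr (-3 * s) * y powr (-3 * s)"
proof -
  have "z powr (-2 * s) = z powr (-s) * z powr (-s)"
    by (simp flip: powr_add)
  also have "\<dots> \<le> x powr (-s) * y powr (-s)"
    using assms by (intro mult_mono powr_mono2') auto
  finally have "x powr (-2 * s) * y powr (-2 * s) * z powr (-2 * s) \<le>
      (x powr (-2 * s) * y powr (-2 * s)) * (x powr (-s) * y powr (-s))"
    using assms by (intro mult_left_mono) auto
  also have "\<dots> = (x powr (-2 * s) * x powr (-s)) * (y powr (-2 * s) * y powr (-s))"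
    by simp
  also have "\<dots> = x powr (-3 * s) * y powr (-3 * s)"
    by (simp flip: powr_add)
  finally show ?thesis .
qed

text \<open>Four forms have no common zero on \<open>K\<close>, so the sum of their moduli has a
  positive minimum there by compactness, and there are only finitely many sets of four.\<close>

lemma forms_small_at_most_three:
  fixes \<alpha> :: "'i \<Rightarrow> 'a::topological_space \<Rightarrow> complex"
  assumes "finite I" and "compact K" and cont: "\<And>i. i \<in> I \<Longrightarrow> continuous_on K (\<alpha> i)"
    and le3: "\<And>v. v \<in> K \<Longrightarrow> card {i\<in>I. \<alpha> i v = 0} \<le> 3"
  obtains c where "0 < c" and "\<And>v. v \<in> K \<Longrightarrow> card {i\<in>I. cmod (\<alpha> i v) < c} \<le> 3"
proof -
  define P where "P = {Q. Q \<subseteq> I \<and> card Q = 4}"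
  have "finite P" unfolding P_def using assms(1) by auto
  have "\<exists>c>0. \<forall>v\<in>K. c \<le> (\<Sum>i\<in>Q. cmod (\<alpha> i v))" if Q: "Q \<in> P" for Q
  proof (cases "K = {}")
    case False
    have cQ: "continuous_on K (\<lambda>v. \<Sum>i\<in>Q. cmod (\<alpha> i v))"
      using Q cont unfolding P_def by (intro continuous_intros) auto
    obtain v where v: "v \<in> K" "\<And>w. w \<in> K \<Longrightarrow> (\<Sum>i\<in>Q. cmod (\<alpha> i v)) \<le> (\<Sum>i\<in>Q. cmod (\<alpha> i w))"
      using continuous_attains_inf[OF assms(2) False cQ] by blast
    have "finite Q" using Q unfolding P_def using assms(1) finite_subset by blast
    have "(\<Sum>i\<in>Q. cmod (\<alpha> i v)) \<noteq> 0"
    proof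
      assume "(\<Sum>i\<in>Q. cmod (\<alpha> i v)) = 0"
      hence "Q \<subseteq> {i\<in>I. \<alpha> i v = 0}"
        using Q \<open>finite Q\<close> unfolding P_def by (auto simp: sum_nonneg_eq_0_iff)
      hence "card Q \<le> card {i\<in>I. \<alpha> i v = 0}"
        using assms(1) by (intro card_mono) auto
      thus False using le3[OF v(1)] Q unfolding P_def by auto
    qed
    moreover have "(\<Sum>i\<in>Q. cmod (\<alpha> i v)) \<ge> 0" by (intro sum_nonneg) auto
    ultimately show ?thesis
      using v(2) by (intro exI[of _ "\<Sum>i\<in>Q. cmod (\<alpha> i v)"]) auto
  qed (auto intro: exI[of _ 1])
  then obtain c where c: "\<And>Q. Q \<in> P \<Longrightarrow> 0 < c Q"
    "\<And>Q v. Q \<in> P \<Longrightarrow> v \<in> K \<Longrightarrow> c Q \<le> (\<Sum>i\<in>Q. cmod (\<alpha> i v))"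
    by metis
  \<comment> \<open>Four moduli below \<open>m\<close> add up to less than 4 m \<le> c Q. The
    inserted 1 keeps the minimum defined when there is no set of four.\<close>
  define m where "m = Min (insert 1 (c ` P)) / 4"
  have mc: "m \<le> c Q / 4" if "Q \<in> P" for Q
    unfolding m_def using that \<open>finite P\<close> by (intro divide_right_mono Min_le) auto
  show thesis
  proof
    show "0 < m" unfolding m_def using \<open>finite P\<close> c(1) by (auto simp: Min_gr_iff)
    fix v assume v: "v \<in> K"
    show "card {i\<in>I. cmod (\<alpha> i v) < m} \<le> 3"
    proof (rule ccontr)
      assume "\<not> ?thesis"
      then obtain Q where Q: "Q \<subseteq> {i\<in>I. cmod (\<alpha> i v) < m}" "card Q = 4"
        using obtain_subset_with_card_n[of 4 "{i\<in>I. cmod (\<alpha> i v) < m}"] by auto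
      hence QP: "Q \<in> P" unfolding P_def by auto
      have "Q \<noteq> {}" "finite Q" using Q(2) by (auto intro: card_ge_0_finite)
      hence "(\<Sum>i\<in>Q. cmod (\<alpha> i v)) < (\<Sum>i\<in>Q. m)"
        using Q(1) by (intro sum_strict_mono) auto
      also have "\<dots> \<le> c Q" using mc[OF QP] Q(2) by simp
      finally show False using c(2)[OF QP v] by simp
    qed
  qed
qed

text \<open>All but three factors are bounded by a power of \<open>c\<close>, and the remaining
  three by one product of two. Which two depends on the point, so the bound sums over all
  pairs.\<close>

lemma prod_powr_forms_bound:
  fixes \<alpha> :: "'i \<Rightarrow> 'a::topological_space \<Rightarrow> complex" and s :: real
  assumes fin: "finite I" and "compact K" and cont: "\<And>i. i \<in> I \<Longrightarrow> continuous_on K (\<alpha> i)"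
    and le3: "\<And>v. v \<in> K \<Longrightarrow> card {i\<in>I. \<alpha> i v = 0} \<le> 3"
    and s: "0 \<le> s" and card: "3 \<le> card I"
  shows "\<exists>C\<ge>0. \<forall>v\<in>K. (\<Prod>i\<in>I. cmod (\<alpha> i v) powr (-2 * s)) \<le>
    C * (\<Sum>i\<in>I. \<Sum>j\<in>I - {i}. cmod (\<alpha> i v) powr (-3 * s) * cmod (\<alpha> j v) powr (-3 * s))"
proof -
  obtain c where c: "0 < c" "\<And>v. v \<in> K \<Longrightarrow> card {i\<in>I. cmod (\<alpha> i v) < c} \<le> 3"
    using forms_small_at_most_three[OF assms(1-4)] by blast
  let ?C = "(c powr (-2 * s)) ^ (card I - 3)"
  have "(\<Prod>i\<in>I. cmod (\<alpha> i v) powr (-2 * s)) \<le>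
    ?C * (\<Sum>i\<in>I. \<Sum>j\<in>I - {i}. cmod (\<alpha> i v) powr (-3 * s) * cmod (\<alpha> j v) powr (-3 * s))"
    (is "_ \<le> ?C * ?S") if v: "v \<in> K" for v
  \<comment> \<open>At a zero of some form the left side is 0, again because
    \<open>0 powr x = 0\<close>.\<close>
  proof (cases "\<exists>i\<in>I. \<alpha> i v = 0")
    case True
    hence "(\<Prod>i\<in>I. cmod (\<alpha> i v) powr (-2 * s)) = 0"
      using fin by auto
    moreover have "0 \<le> ?C * ?S"
      by (intro mult_nonneg_nonneg sum_nonneg) auto
    ultimately show ?thesis by simp
  next
    case False
    define x where "x i = cmod (\<alpha> i v)" for i
    have x: "0 < x i" if "i \<in> I" for i using False that by (auto simp: x_def)
    \<comment> \<open>The set of small forms is padded to exactly three elements; this is what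
      \<open>3 \<le> card I\<close> provides for.\<close>
    obtain J where J: "{i\<in>I. x i < c} \<subseteq> J" "J \<subseteq> I" "card J = 3"
      using exists_subset_between[of "{i\<in>I. x i < c}" 3 I] c(2)[OF v] card fin
      by (auto simp: x_def)
    have two: "x i powr (-3 * s) * x j powr (-3 * s) \<le> ?S" if "i \<in> I" "j \<in> I" "i \<noteq> j" for i j
    proof -
      have "x i powr (-3 * s) * x j powr (-3 * s) \<le> (\<Sum>j\<in>I - {i}. x i powr (-3 * s) * x j powr (-3 * s))"
        using that fin by (intro member_le_sum) auto
      also have "\<dots> \<le> ?S" unfolding x_def[symmetric]
        using that fin by (intro member_le_sum[of i I "\<lambda>i. \<Sum>j\<in>I - {i}. x i powr (-3 * s) * x j powr (-3 * s)"]) (auto intro!: sum_nonneg)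
      finally show ?thesis .
    qed
    have "(\<Prod>i\<in>J. x i powr (-2 * s)) \<le> ?S"
    proof -
      obtain i j k where ijk: "J = {i,j,k}" "i \<noteq> j" "j \<noteq> k" "i \<noteq> k"
        using J(3) by (auto simp: card_3_iff)
      hence I: "i \<in> I" "j \<in> I" "k \<in> I" using J(2) by auto
      have p: "(\<Prod>i\<in>J. x i powr (-2 * s)) = x i powr (-2 * s) * x j powr (-2 * s) * x k powr (-2 * s)"
        "(\<Prod>i\<in>J. x i powr (-2 * s)) = x i powr (-2 * s) * x k powr (-2 * s) * x j powr (-2 * s)"
        "(\<Prod>i\<in>J. x i powr (-2 * s)) = x j powr (-2 * s) * x k powr (-2 * s) * x i powr (-2 * s)"
        using ijk by simp_all
      consider "x i \<le> x k" "x j \<le> x k" | "x i \<le> x j" "x k \<le> x j" | "x j \<le> x i" "x k \<le> x i"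
        by linarith
      thus ?thesis
      proof cases
        case 1
        from powr_three_le_two[OF x[OF I(1)] x[OF I(2)] 1 s] two[OF I(1,2) ijk(2)] show ?thesis
          by (simp only: p(1))
      next
        case 2
        from powr_three_le_two[OF x[OF I(1)] x[OF I(3)] 2 s] two[OF I(1,3) ijk(4)] show ?thesis
          by (simp only: p(2))
      next
        case 3
        from powr_three_le_two[OF x[OF I(2)] x[OF I(3)] 3 s] two[OF I(2,3) ijk(3)] show ?thesis
          by (simp only: p(3))
      qed
    qed
    moreover have "(\<Prod>i\<in>I - J. x i powr (-2 * s)) \<le> ?C"
    proof -
      have "(\<Prod>i\<in>I - J. x i powr (-2 * s)) \<le> (\<Prod>i\<in>I - J. c powr (-2 * s))"
        using J c(1) s by (intro prod_mono) (auto intro!: powr_mono2')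
      also have "\<dots> = ?C"
        using J fin by (simp add: card_Diff_subset finite_subset)
      finally show ?thesis .
    qed
    moreover have "(\<Prod>i\<in>I. x i powr (-2 * s)) = (\<Prod>i\<in>I - J. x i powr (-2 * s)) * (\<Prod>i\<in>J. x i powr (-2 * s))"
      using J fin by (simp add: prod.subset_diff)
    ultimately show ?thesis
      unfolding x_def[symmetric] by (auto intro!: mult_mono prod_nonneg)
  qed
  thus ?thesis by (intro exI[of _ ?C] conjI ballI) auto
qed

lemma set_integrable_prod_powr_forms:
  fixes a :: "'i \<Rightarrow> complex^'n" and s :: real
  assumes fin: "finite I" and K: "compact K"
    and le3: "\<And>v. v \<in> K \<Longrightarrow> card {i\<in>I. linform (a i) v = 0} \<le> 3"
    and indep: "\<And>i j. i \<in> I \<Longrightarrow> j \<in> I \<Longrightarrow> i \<noteq> j \<Longrightarrow> \<exists>e. linform (a i) e = 1 \<and> linform (a j) e = 0"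
    and s: "0 \<le> s" "3 * s < 2" and card: "3 \<le> card I"
  shows "set_integrable lborel K (\<lambda>v. \<Prod>i\<in>I. cmod (linform (a i) v) powr (-2 * s))"
proof -
  have c: "continuous_on K (linform (a i))" for i
    by (rule continuous_on_linform[OF continuous_on_id])
  define Z where "Z v = (\<Sum>i\<in>I. \<Sum>j\<in>I - {i}.
      cmod (linform (a i) v) powr (-3 * s) * cmod (linform (a j) v) powr (-3 * s))" for v
  have "\<exists>C\<ge>0. \<forall>v\<in>K. (\<Prod>i\<in>I. cmod (linform (a i) v) powr (-2 * s)) \<le> C * Z v"
    unfolding Z_def by (rule prod_powr_forms_bound) (use fin K c le3 s(1) card in auto)
  then obtain C where C: "\<forall>v\<in>K. (\<Prod>i\<in>I. cmod (linform (a i) v) powr (-2 * s)) \<le> C * Z v"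
    by auto
  obtain R where "\<forall>x\<in>K. norm x \<le> R"
    using compact_imp_bounded[OF K] unfolding bounded_iff by blast
  hence R: "K \<subseteq> cball 0 R" by auto
  have pair: "set_integrable lborel K (\<lambda>v. cmod (linform (a i) v) powr (-3 * s) * cmod (linform (a j) v) powr (-3 * s))"
    if ij: "i \<in> I" "j \<in> I" "i \<noteq> j" for i j
  proof -
    obtain e e' where "linform (a i) e = 1" "linform (a j) e = 0" "linform (a j) e' = 1"
      using indep[OF ij] indep[OF ij(2,1)] ij(3) by metis
    from nn_integral_two_forms[OF _ _ this, of "3 * s" R] s
    have fin: "(\<integral>\<^sup>+v\<in>cball 0 R. ennreal (cmod (linform (a i) v) powr (-3 * s) * cmod (linform (a j) v) powr (-3 * s)) \<partial>lborel) < \<infinity>"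
      by simp
    have "set_integrable lborel (cball 0 R) (\<lambda>v. cmod (linform (a i) v) powr (-3 * s) * cmod (linform (a j) v) powr (-3 * s))"
      unfolding set_integrable_def
    proof (rule integrableI_bounded)
      show "(\<integral>\<^sup>+v. norm (indicat_real (cball 0 R) v *\<^sub>R (cmod (linform (a i) v) powr (-3 * s) * cmod (linform (a j) v) powr (-3 * s))) \<partial>lborel) < \<infinity>"
        using fin by (simp add: abs_mult indicator_mult_ennreal mult.commute flip: ennreal_indicator ennreal_mult)
    qed measurable
    thus ?thesis
      using K R by (auto intro: set_integrable_subset simp: borel_compact)
  qed
  have "set_integrable lborel K (\<lambda>v. C * Z v)"
    using pair unfolding Z_def set_integrable_def sum_distrib_left real_scaleR_def mult.left_commute[of _ C]
    by (intro Bochner_Integration.integrable_sum integrable_mult_right) auto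
  thus ?thesis
    unfolding set_integrable_def
  proof (rule Bochner_Integration.integrable_bound)
    have [measurable]: "K \<in> sets borel" using K by (rule borel_compact)
    show "(\<lambda>v. indicat_real K v *\<^sub>R (\<Prod>i\<in>I. cmod (linform (a i) v) powr (-2 * s))) \<in> borel_measurable lborel"
      by measurable
    have pos: "0 \<le> (\<Prod>i\<in>I. cmod (linform (a i) v) powr (-2 * s))" for v
      by (intro prod_nonneg) auto
    have "norm (indicat_real K v *\<^sub>R (\<Prod>i\<in>I. cmod (linform (a i) v) powr (-2 * s))) \<le>
       norm (indicat_real K v *\<^sub>R (C * Z v))" for v
    proof (cases "v \<in> K")
      case True
      with C have "(\<Prod>i\<in>I. cmod (linform (a i) v) powr (-2 * s)) \<le> \<bar>C * Z v\<bar>"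
        by (auto intro: order_trans[OF _ abs_ge_self])
      with True pos[of v] show ?thesis
        by (simp only: indicator_simps scaleR_one real_norm_def abs_of_nonneg)
    qed simp
    thus "AE v in lborel. norm (indicat_real K v *\<^sub>R (\<Prod>i\<in>I. cmod (linform (a i) v) powr (-2 * s))) \<le>
       norm (indicat_real K v *\<^sub>R (C * Z v))"
      by (rule AE_I2)
  qed
qed

lemma null_set_linform_eq_0:
  assumes "a \<noteq> (0::complex^'n)"
  shows "{v. linform a v = 0} \<in> null_sets lborel"
proof -
  obtain i where i: "a $ i \<noteq> 0" using assms by (auto simp: vec_eq_iff)
  have "subspace {v. linform a v = 0}"
    by (auto simp: subspace_def linform_add linform_scaleR) (simp add: linform_def)
  moreover have "axis i 1 \<notin> {v. linform a v = 0}"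
    using i by (simp add: linform_def axis_def if_distrib sum.delta cong: if_cong)
  hence "{v. linform a v = 0} \<noteq> UNIV" by blast
  ultimately have "negligible {v. linform a v = 0}"
    by (metis dim_eq_full negligible_lowdim span_eq_iff dim_subset_UNIV le_neq_implies_less)
  moreover have "{v. linform a v = 0} \<in> sets lborel"
    by measurable
  ultimately show ?thesis
    by (metis negligible_iff_null_sets null_sets_completion_iff)
qed

section \<open>A Stokes identity for fields tangent to a hypersurface\<close>

text \<open>The families \<open>A\<close> and \<open>B\<close> are the derivatives of \<open>G\<close> with respect to the coordinates and to
  their conjugates.\<close>

definition wirtinger ::
  "(complex^'n \<Rightarrow> complex) \<Rightarrow> ('n \<Rightarrow> complex) \<Rightarrow> ('n \<Rightarrow> complex) \<Rightarrow> complex^'n \<Rightarrow> bool" where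
  "wirtinger G A B v \<longleftrightarrow>
     (G has_derivative (\<lambda>h. \<Sum>k\<in>UNIV. A k * h $ k + B k * cnj (h $ k))) (at v)"

lemma wirtinger_eq_rhs:
  "wirtinger G A B v \<Longrightarrow> (\<And>k. A k = A' k) \<Longrightarrow> (\<And>k. B k = B' k) \<Longrightarrow> wirtinger G A' B' v"
  by (simp add: wirtinger_def)

lemma wirtinger_mult:
  assumes "wirtinger F A B v" "wirtinger G A' B' v"
  shows "wirtinger (\<lambda>v. F v * G v) (\<lambda>k. A k * G v + F v * A' k) (\<lambda>k. B k * G v + F v * B' k) v"
  unfolding wirtinger_def
  by (rule has_derivative_eq_rhs[OF has_derivative_mult[OF assms[unfolded wirtinger_def]]])
    (simp only: fun_eq_iff sum_distrib_left sum_distrib_right distrib_left distrib_right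
      sum.distrib mult_ac add_ac simp_thms)

lemma wirtinger_diff:
  assumes "wirtinger F A B v" "wirtinger G A' B' v"
  shows "wirtinger (\<lambda>v. F v - G v) (\<lambda>k. A k - A' k) (\<lambda>k. B k - B' k) v"
  unfolding wirtinger_def
  by (rule has_derivative_eq_rhs[OF has_derivative_diff[OF assms[unfolded wirtinger_def]]])
    (simp add: fun_eq_iff left_diff_distrib sum.distrib sum_subtractf)

lemma wirtinger_sum:
  assumes "\<And>i. i \<in> I \<Longrightarrow> wirtinger (F i) (A i) (B i) v"
  shows "wirtinger (\<lambda>v. \<Sum>i\<in>I. F i v) (\<lambda>k. \<Sum>i\<in>I. A i k) (\<lambda>k. \<Sum>i\<in>I. B i k) v"
proof -
  have "((\<lambda>v. \<Sum>i\<in>I. F i v) has_derivative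
      (\<lambda>h. \<Sum>i\<in>I. \<Sum>k\<in>UNIV. A i k * h $ k + B i k * cnj (h $ k))) (at v)"
    using assms unfolding wirtinger_def by (rule has_derivative_sum)
  also have "(\<lambda>h. \<Sum>i\<in>I. \<Sum>k\<in>UNIV. A i k * h $ k + B i k * cnj (h $ k)) =
      (\<lambda>h. \<Sum>k\<in>UNIV. (\<Sum>i\<in>I. A i k) * h $ k + (\<Sum>i\<in>I. B i k) * cnj (h $ k))"
    by (subst sum.swap) (simp add: sum.distrib sum_distrib_right)
  finally show ?thesis by (simp add: wirtinger_def)
qed

lemma wirtinger_cnj:
  assumes "wirtinger F A B v"
  shows "wirtinger (\<lambda>v. cnj (F v)) (\<lambda>k. cnj (B k)) (\<lambda>k. cnj (A k)) v"
  unfolding wirtinger_def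
  by (rule has_derivative_eq_rhs[OF bounded_linear.has_derivative[OF bounded_linear_cnj assms[unfolded wirtinger_def]]])
    (simp add: fun_eq_iff add.commute)

lemma wirtinger_vec_nth: "wirtinger (\<lambda>v. v $ i) (\<lambda>k. if k = i then 1 else 0) (\<lambda>_. 0) v"
  unfolding wirtinger_def
  by (rule has_derivative_eq_rhs[OF bounded_linear_imp_has_derivative[OF bounded_linear_vec_nth]])
    (simp add: fun_eq_iff if_distrib[of "\<lambda>x. x * _"] cong: if_cong)

lemma wirtinger_of_real_comp:
  assumes \<rho>: "wirtinger (\<lambda>v. complex_of_real (\<rho> v)) A B v"
    and g: "(g has_real_derivative g') (at (\<rho> v))"
  shows "wirtinger (\<lambda>v. complex_of_real (g (\<rho> v))) (\<lambda>k. of_real g' * A k) (\<lambda>k. of_real g' * B k) v"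
proof -
  let ?D = "\<lambda>h. \<Sum>k\<in>UNIV. A k * h $ k + B k * cnj (h $ k)"
  have D: "((\<lambda>v. complex_of_real (\<rho> v)) has_derivative ?D) (at v)"
    using \<rho> by (simp add: wirtinger_def)
  have R: "(\<rho> has_derivative (\<lambda>h. Re (?D h))) (at v)"
    using bounded_linear.has_derivative[OF bounded_linear_Re D] by simp
  \<comment> \<open>The derivative of a real-valued function is real-valued, by uniqueness of
    derivatives.\<close>
  have "?D = (\<lambda>h. complex_of_real (Re (?D h)))"
    by (rule has_derivative_unique[OF D bounded_linear.has_derivative[OF bounded_linear_of_real R]])
  hence Dh: "complex_of_real (Re (?D h)) = ?D h" for h by metis
  have "((\<lambda>v. g (\<rho> v)) has_derivative (\<lambda>h. g' * Re (?D h))) (at v)"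
    by (rule has_derivative_compose[OF R g[unfolded has_field_derivative_def]])
  from bounded_linear.has_derivative[OF bounded_linear_of_real[where 'a = complex] this]
  have "((\<lambda>v. complex_of_real (g (\<rho> v))) has_derivative (\<lambda>h. of_real g' * ?D h)) (at v)"
    by (simp only: of_real_mult Dh)
  thus ?thesis
    unfolding wirtinger_def by (simp add: sum_distrib_left distrib_left mult.assoc)
qed

lemma wirtinger_imp_isCont: "wirtinger F A B v \<Longrightarrow> isCont F v"
  unfolding wirtinger_def by (rule has_derivative_continuous)

lemma integral_wirtinger_eq_0:
  fixes G :: "complex^'n \<Rightarrow> complex"
  assumes G: "\<And>v. wirtinger G (A v) (B v) v"
    and cA: "continuous_on UNIV (\<lambda>v. A v k)" and cB: "continuous_on UNIV (\<lambda>v. B v k)"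
    and supp: "\<And>v. norm v \<ge> R \<Longrightarrow> G v = 0"
  shows "integrable lborel (\<lambda>v. A v k)" and "(LBINT v. A v k) = 0"
proof -
  let ?G' = "\<lambda>v h. \<Sum>k\<in>UNIV. A v k * h $ k + B v k * cnj (h $ k)"
  have G': "(G has_derivative ?G' v) (at v)" for v
    using G by (simp add: wirtinger_def)
  have ax: "?G' v (axis k z) = A v k * z + B v k * cnj z" for v z
    by (simp add: axis_def sum.distrib if_distrib if_distrib[of cnj] cong: if_cong)
  define F where "F z v = A v k * z + B v k * cnj z" for z v
  have int: "integrable lborel (F z)" and zero: "integral\<^sup>L lborel (F z) = 0" for z
  proof -
    have cont: "continuous_on UNIV (F z)"
      unfolding F_def by (intro continuous_intros cA cB)
    show "integrable lborel (F z)" "integral\<^sup>L lborel (F z) = 0"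
      using integral_directional_derivative_eq_0[OF G' _ supp, of "axis k z" R] cont
      unfolding ax F_def[symmetric] by auto
  qed
  \<comment> \<open>The Wirtinger derivative is half of the derivative in the direction 1 minus
    \<open>\<i>\<close> times the one in the direction \<open>\<i>\<close>.\<close>
  have A: "(\<lambda>v. A v k) = (\<lambda>v. (F 1 v - \<i> * F \<i> v) / 2)"
    by (simp add: F_def algebra_simps)
  show "integrable lborel (\<lambda>v. A v k)"
    unfolding A by (intro integrable_divide Bochner_Integration.integrable_diff integrable_mult_right int)
  show "(LBINT v. A v k) = 0"
    unfolding A by (simp add: int zero)
qed

text \<open>Holomorphy is expressed by vanishing conjugate derivatives, and homogeneity of degrees
  \<open>d\<close> and \<open>r\<close> enters only through the Euler identities. Equation
  \<open>sd\<close> fixes the exponent for which the radial terms cancel; in three variables it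
  reads s d = r + 2.\<close>

locale tangent_field =
  fixes f :: "complex^'n \<Rightarrow> complex" and Df :: "complex^'n \<Rightarrow> 'n \<Rightarrow> complex"
    and T :: "'n \<Rightarrow> complex^'n \<Rightarrow> complex" and DT :: "'n \<Rightarrow> complex^'n \<Rightarrow> 'n \<Rightarrow> complex"
    and d r :: nat and s :: real
  assumes f: "wirtinger f (Df v) (\<lambda>_. 0) v"
    and T: "wirtinger (T i) (DT i v) (\<lambda>_. 0) v"
    and cont_Df: "continuous_on UNIV (\<lambda>v. Df v k)"
    and cont_DT: "continuous_on UNIV (\<lambda>v. DT i v k)"
    and euler_f: "(\<Sum>k\<in>UNIV. Df v k * v $ k) = of_nat d * f v"
    and euler_T: "(\<Sum>k\<in>UNIV. DT i v k * v $ k) = of_nat r * T i v"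
    and tangent: "(\<Sum>k\<in>UNIV. T k v * Df v k) = 0"
    and sd: "s * real d = real r + real CARD('n) - 1"
begin

text \<open>\<open>N\<close> is the squared norm, \<open>S\<close> the Hermitian product of the
  field with the radial vector, and \<open>L\<close> the complex divergence of the field.\<close>

definition N :: "complex^'n \<Rightarrow> complex" where "N v = (\<Sum>k\<in>UNIV. v $ k * cnj (v $ k))"
definition S :: "complex^'n \<Rightarrow> complex" where "S v = (\<Sum>k\<in>UNIV. T k v * cnj (v $ k))"
definition L :: "complex^'n \<Rightarrow> complex" where "L v = (\<Sum>k\<in>UNIV. DT k v k)"

text \<open>The part of \<open>T\<close> orthogonal to the radial direction, multiplied by \<open>N\<close> to clear the
  denominator. It annihilates every function of the norm.\<close>

definition P :: "'n \<Rightarrow> complex^'n \<Rightarrow> complex" where "P k v = N v * T k v - S v * v $ k"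

lemma N_eq: "N v = of_real ((norm v)\<^sup>2)"
  by (simp add: N_def complex_norm_square norm_vec_def L2_set_def sum_nonneg flip: of_real_power)

lemma cont_f: "continuous_on UNIV f" and cont_T: "continuous_on UNIV (T i)"
  using f T wirtinger_imp_isCont by (meson continuous_at_imp_continuous_on)+

lemma cont_N: "continuous_on UNIV N" and cont_S: "continuous_on UNIV S"
  and cont_L: "continuous_on UNIV L" and cont_P: "continuous_on UNIV (P k)"
proof -
  show N: "continuous_on UNIV N" and S: "continuous_on UNIV S" and "continuous_on UNIV L"
    unfolding N_def S_def L_def by (intro continuous_intros cont_T cont_DT)+
  show "continuous_on UNIV (P k)"
    unfolding P_def by (intro continuous_intros N S cont_T)
qed

lemma wirtinger_N: "wirtinger N (\<lambda>k. cnj (v $ k)) (\<lambda>k. v $ k) v"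
  unfolding N_def
  by (rule wirtinger_eq_rhs, rule wirtinger_sum, rule wirtinger_mult,
      rule wirtinger_vec_nth, rule wirtinger_cnj, rule wirtinger_vec_nth)
    (simp_all add: if_distrib[of "\<lambda>x. x * _"] if_distrib[of cnj] if_distrib[of "\<lambda>x. _ * x"] cong: if_cong)

lemma wirtinger_S: "wirtinger S (\<lambda>k. \<Sum>i\<in>UNIV. DT i v k * cnj (v $ i)) (\<lambda>k. T k v) v"
  unfolding S_def
  by (rule wirtinger_eq_rhs, rule wirtinger_sum, rule wirtinger_mult,
      rule T, rule wirtinger_cnj, rule wirtinger_vec_nth)
    (simp_all add: if_distrib[of "\<lambda>x. x * _"] if_distrib[of cnj] if_distrib[of "\<lambda>x. _ * x"] cong: if_cong)

definition PA :: "'n \<Rightarrow> complex^'n \<Rightarrow> 'n \<Rightarrow> complex" where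
  "PA k v j = (cnj (v $ j) * T k v + N v * DT k v j) -
     ((\<Sum>i\<in>UNIV. DT i v j * cnj (v $ i)) * v $ k + S v * (if j = k then 1 else 0))"

definition PB :: "'n \<Rightarrow> complex^'n \<Rightarrow> 'n \<Rightarrow> complex" where
  "PB k v j = v $ j * T k v - T j v * v $ k"

lemma wirtinger_P: "wirtinger (P k) (PA k v) (PB k v) v"
  unfolding P_def
  by (rule wirtinger_eq_rhs, rule wirtinger_diff, rule wirtinger_mult, rule wirtinger_N, rule T,
      rule wirtinger_mult, rule wirtinger_S, rule wirtinger_vec_nth) (simp_all add: PA_def PB_def)

lemma cont_PA: "continuous_on UNIV (\<lambda>v. PA k v j)" and cont_PB: "continuous_on UNIV (\<lambda>v. PB k v j)"
  unfolding PA_def PB_def by (intro continuous_intros cont_T cont_N cont_S cont_DT)+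

text \<open>Differentiating \<open>N\<close> returns \<open>S\<close> once. Differentiating
  \<open>S v * v $ k\<close> costs \<open>r\<close> copies of \<open>S\<close> by Euler's identity
  and one more for each coordinate. The total factor -(r + n - 1), with n the number of coordinates,
  is -s d by \<open>sd\<close>.\<close>

lemma sum_PA: "(\<Sum>k\<in>UNIV. PA k v k) = N v * L v - of_real (s * real d) * S v"
proof -
  have "(\<Sum>k\<in>UNIV. (\<Sum>i\<in>UNIV. DT i v k * cnj (v $ i)) * v $ k) =
      (\<Sum>i\<in>UNIV. (\<Sum>k\<in>UNIV. DT i v k * v $ k) * cnj (v $ i))"
    unfolding sum_distrib_right by (subst sum.swap) (simp add: mult_ac)
  also have "\<dots> = of_nat r * S v"
    by (simp add: euler_T S_def sum_distrib_left mult.assoc)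
  finally have 1: "(\<Sum>k\<in>UNIV. (\<Sum>i\<in>UNIV. DT i v k * cnj (v $ i)) * v $ k) = of_nat r * S v" .
  have 2: "(\<Sum>k\<in>UNIV. cnj (v $ k) * T k v) = S v"
    by (simp add: S_def mult.commute)
  have "(\<Sum>k\<in>UNIV. PA k v k) = (S v + N v * L v) - (of_nat r * S v + of_nat CARD('n) * S v)"
    unfolding PA_def sum_subtractf sum.distrib 1 2 L_def by (simp add: sum_distrib_left)
  thus ?thesis by (simp add: sd algebra_simps)
qed

lemma sum_P_radial: "(\<Sum>k\<in>UNIV. cnj (v $ k) * P k v) = 0"
proof -
  have "(\<Sum>k\<in>UNIV. cnj (v $ k) * P k v) =
      N v * (\<Sum>k\<in>UNIV. T k v * cnj (v $ k)) - S v * (\<Sum>k\<in>UNIV. v $ k * cnj (v $ k))"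
    by (simp add: P_def right_diff_distrib sum_subtractf sum_distrib_left mult_ac)
  thus ?thesis by (simp flip: S_def N_def)
qed

text \<open>The projected field no longer annihilates \<open>f\<close>, but it sends
  \<open>f\<close> to a multiple of \<open>f\<close>. The derivative of the weight along it is
  therefore no more singular than the weight itself.\<close>

lemma sum_P_Df: "(\<Sum>k\<in>UNIV. Df v k * P k v) = - (S v * of_nat d * f v)"
proof -
  have "(\<Sum>k\<in>UNIV. Df v k * P k v) =
      N v * (\<Sum>k\<in>UNIV. T k v * Df v k) - S v * (\<Sum>k\<in>UNIV. Df v k * v $ k)"
    unfolding P_def right_diff_distrib sum_subtractf sum_distrib_left by (simp add: mult_ac)
  thus ?thesis by (simp add: tangent euler_f)
qed

text \<open>The weight |f|^(-2 s), regularised so as to be continuously differentiable across the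
  zeros of \<open>f\<close>. Its companion \<open>W'\<close> is the derivative with respect to
  |f|^2.\<close>

definition W :: "real \<Rightarrow> complex^'n \<Rightarrow> real" where
  "W \<epsilon> v = ((cmod (f v))\<^sup>2 + \<epsilon>) powr (- s)"

definition W' :: "real \<Rightarrow> complex^'n \<Rightarrow> real" where
  "W' \<epsilon> v = (- s) * ((cmod (f v))\<^sup>2 + \<epsilon>) powr (- s - 1)"

lemma wirtinger_W:
  assumes "\<epsilon> > 0"
  shows "wirtinger (\<lambda>v. of_real (W \<epsilon> v)) (\<lambda>k. of_real (W' \<epsilon> v) * (Df v k * cnj (f v)))
    (\<lambda>k. of_real (W' \<epsilon> v) * (f v * cnj (Df v k))) v"
proof -
  have pos: "(cmod (f v))\<^sup>2 + \<epsilon> > 0" using assms by (simp add: add_nonneg_pos)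
  have "wirtinger (\<lambda>v. f v * cnj (f v)) (\<lambda>k. Df v k * cnj (f v)) (\<lambda>k. f v * cnj (Df v k)) v"
    by (rule wirtinger_eq_rhs, rule wirtinger_mult, rule f, rule wirtinger_cnj, rule f) simp_all
  hence F: "wirtinger (\<lambda>v. complex_of_real ((cmod (f v))\<^sup>2)) (\<lambda>k. Df v k * cnj (f v))
      (\<lambda>k. f v * cnj (Df v k)) v"
    by (simp only: complex_norm_square)
  have "((\<lambda>x. (x + \<epsilon>) powr (- s)) has_real_derivative
      (- s) * ((cmod (f v))\<^sup>2 + \<epsilon>) powr (- s - 1)) (at ((cmod (f v))\<^sup>2))"
    using pos by (auto intro!: derivative_eq_intros)
  from wirtinger_of_real_comp[OF F this] show ?thesis
    by (simp add: W_def[abs_def] W'_def)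
qed

lemma cont_W: "\<epsilon> > 0 \<Longrightarrow> continuous_on UNIV (W \<epsilon>)" and cont_W': "\<epsilon> > 0 \<Longrightarrow> continuous_on UNIV (W' \<epsilon>)"
  unfolding W_def[abs_def] W'_def[abs_def]
  by (intro continuous_intros cont_f; simp add: add_nonneg_eq_0_iff)+

text \<open>The integrand is the divergence of the cutoff times \<open>\<psi>\<close> times
  \<open>W\<close> times \<open>P\<close>. The derivative of the cutoff is radial and drops out. The
  derivative of \<open>W\<close> yields s d |f|^2 / (|f|^2 + \<epsilon>) times \<open>S\<close> and
  the divergence of \<open>P\<close> yields -s d times \<open>S\<close>; their sum is the error term
  with \<epsilon> in the numerator.\<close>

lemma stokes_identity:
  assumes \<psi>: "\<And>v. wirtinger \<psi> (A v) (B v) v"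
    and cA: "\<And>k. continuous_on UNIV (\<lambda>v. A v k)" and cB: "\<And>k. continuous_on UNIV (\<lambda>v. B v k)"
    and \<phi>: "\<And>t. (\<phi> has_real_derivative \<phi>' t) (at t)" and c\<phi>': "continuous_on UNIV \<phi>'"
    and supp: "\<And>t. t \<ge> R\<^sup>2 \<Longrightarrow> \<phi> t = 0" and R: "0 \<le> R" and \<epsilon>: "\<epsilon> > 0"
  shows "(LBINT v. of_real (\<phi> ((norm v)\<^sup>2) * W \<epsilon> v) * ((\<Sum>k\<in>UNIV. A v k * P k v) +
      \<psi> v * (N v * L v - of_real (s * real d * (\<epsilon> / ((cmod (f v))\<^sup>2 + \<epsilon>))) * S v))) = 0"
proof -
  define X where "X v = \<phi> ((norm v)\<^sup>2)" for v :: "complex^'n"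
  define X' where "X' v = \<phi>' ((norm v)\<^sup>2)" for v :: "complex^'n"
  define G where "G k v = of_real (X v) * (\<psi> v * (of_real (W \<epsilon> v) * P k v))" for k v
  define GA where "GA k v j = of_real (X' v) * cnj (v $ j) * (\<psi> v * (of_real (W \<epsilon> v) * P k v)) +
    of_real (X v) * (A v j * (of_real (W \<epsilon> v) * P k v) +
     \<psi> v * (of_real (W' \<epsilon> v) * (Df v j * cnj (f v)) * P k v + of_real (W \<epsilon> v) * PA k v j))" for k v j
  define GB where "GB k v j = of_real (X' v) * v $ j * (\<psi> v * (of_real (W \<epsilon> v) * P k v)) +
    of_real (X v) * (B v j * (of_real (W \<epsilon> v) * P k v) +
     \<psi> v * (of_real (W' \<epsilon> v) * (f v * cnj (Df v j)) * P k v + of_real (W \<epsilon> v) * PB k v j))" for k v j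
  have wX: "wirtinger (\<lambda>v. of_real (X v)) (\<lambda>k. of_real (X' v) * cnj (v $ k)) (\<lambda>k. of_real (X' v) * v $ k) v" for v
    unfolding X_def X'_def
    by (rule wirtinger_of_real_comp[OF _ \<phi>]) (use wirtinger_N in \<open>simp add: N_eq[abs_def]\<close>)
  have wG: "wirtinger (G k) (GA k v) (GB k v) v" for k v
    unfolding G_def GA_def[abs_def] GB_def[abs_def]
    by (intro wirtinger_mult wX \<psi> wirtinger_W \<epsilon> wirtinger_P)
  have c\<phi>: "continuous_on UNIV \<phi>"
    using \<phi> by (meson DERIV_isCont continuous_at_imp_continuous_on)
  have c\<psi>: "continuous_on UNIV \<psi>"
    using \<psi> wirtinger_imp_isCont by (meson continuous_at_imp_continuous_on)
  have cX: "continuous_on UNIV X" "continuous_on UNIV X'"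
    unfolding X_def X'_def
    by (rule continuous_on_compose2[OF c\<phi>] continuous_on_compose2[OF c\<phi>'], intro continuous_intros, simp)+
  have cGA: "continuous_on UNIV (\<lambda>v. GA k v j)" and cGB: "continuous_on UNIV (\<lambda>v. GB k v j)" for k j
    unfolding GA_def GB_def
    by (intro continuous_intros cX c\<psi> cA cB cont_W cont_W' \<epsilon> cont_P cont_PA cont_PB cont_Df cont_f)+
  have suppG: "G k v = 0" if "norm v \<ge> R" for k v
    using supp[of "(norm v)\<^sup>2"] that R by (simp add: G_def X_def power_mono)
  note I = integral_wirtinger_eq_0[OF wG cGA cGB suppG]
  have int: "(LBINT v. (\<Sum>k\<in>UNIV. GA k v k)) = 0"
    using I by (simp add: integral_sum)
  have eq: "(\<Sum>k\<in>UNIV. GA k v k) = of_real (\<phi> ((norm v)\<^sup>2) * W \<epsilon> v) * ((\<Sum>k\<in>UNIV. A v k * P k v) +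
      \<psi> v * (N v * L v - of_real (s * real d * (\<epsilon> / ((cmod (f v))\<^sup>2 + \<epsilon>))) * S v))" for v
  proof -
    define q where "q = (cmod (f v))\<^sup>2 + \<epsilon>"
    have q: "q > 0" using \<epsilon> by (simp add: q_def add_nonneg_pos)
    have W': "W' \<epsilon> v = - s * W \<epsilon> v / q"
      using q by (simp add: W_def W'_def powr_diff flip: q_def)
    have qc: "f v * cnj (f v) = of_real (q - \<epsilon>)"
      by (simp only: q_def add_diff_cancel_right' complex_norm_square)
    have "(\<Sum>k\<in>UNIV. GA k v k) =
        of_real (X' v) * \<psi> v * of_real (W \<epsilon> v) * (\<Sum>k\<in>UNIV. cnj (v $ k) * P k v) +
        of_real (X v) * (of_real (W \<epsilon> v) * (\<Sum>k\<in>UNIV. A v k * P k v) +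
          \<psi> v * (of_real (W' \<epsilon> v) * cnj (f v) * (\<Sum>k\<in>UNIV. Df v k * P k v) +
            of_real (W \<epsilon> v) * (\<Sum>k\<in>UNIV. PA k v k)))"
      unfolding GA_def sum_distrib_left distrib_left sum.distrib by (simp add: mult_ac)
    also have "\<dots> = of_real (X v) * (of_real (W \<epsilon> v) * (\<Sum>k\<in>UNIV. A v k * P k v) +
          \<psi> v * (of_real (s * W \<epsilon> v / q) * of_nat d * S v * (f v * cnj (f v)) +
            of_real (W \<epsilon> v) * (N v * L v - of_real (s * real d) * S v)))"
      unfolding sum_P_radial sum_P_Df sum_PA W' by (simp add: mult_ac)
    also have "\<dots> = of_real (X v * W \<epsilon> v) * ((\<Sum>k\<in>UNIV. A v k * P k v) +
          \<psi> v * (N v * L v - of_real (s * real d * (\<epsilon> / q)) * S v))"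
      unfolding qc using q by (simp add: field_simps)
    finally show ?thesis by (simp add: X_def q_def)
  qed
  show ?thesis using int by (simp only: eq)
qed

end

section \<open>A continuously differentiable cutoff supported on a spherical shell\<close>

lemma open_null_set_empty:
  fixes A :: "'a::euclidean_space set"
  assumes "open A" and "AE x in lborel. x \<notin> A"
  shows "A = {}"
proof -
  have "A \<in> null_sets lborel"
    using assms by (subst (asm) AE_iff_null_sets[symmetric]) auto
  hence "negligible A"
    by (simp add: negligible_iff_null_sets null_sets_completionI)
  thus ?thesis
    using assms(1) open_not_negligible by blast
qed

text \<open>The argument is the squared norm, so the zeros 1 and 4 correspond to the radii 1 and 2.
  Squaring the positive part gives one continuous derivative, all that integration by parts
  uses.\<close>

definition bump :: "real \<Rightarrow> real" where "bump t = (max 0 ((t - 1) * (4 - t)))\<^sup>2"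
definition bump' :: "real \<Rightarrow> real" where "bump' t = 2 * max 0 ((t - 1) * (4 - t)) * (5 - 2 * t)"

lemma has_real_derivative_max_0_squared:
  "((\<lambda>x. (max 0 x)\<^sup>2) has_real_derivative 2 * max 0 x) (at x)" for x :: real
proof -
  consider "x > 0" | "x < 0" | "x = 0" by linarith
  thus ?thesis
  proof cases
    case 1
    have "((\<lambda>x. x\<^sup>2) has_real_derivative 2 * max 0 x) (at x)"
      using 1 by (auto intro!: derivative_eq_intros)
    thus ?thesis
      by (rule has_field_derivative_transform_within_open[of _ _ _ "{0<..}"]) (use 1 in auto)
  next
    case 2
    have "((\<lambda>x. 0) has_real_derivative 2 * max 0 x) (at x)"
      using 2 by (auto intro!: derivative_eq_intros)
    thus ?thesis
      by (rule has_field_derivative_transform_within_open[of _ _ _ "{..<0}"]) (use 2 in auto)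
  next
    case 3
    have "((\<lambda>h. (max 0 h)\<^sup>2 / h) \<longlongrightarrow> 0) (at (0::real))"
    proof (rule Lim_null_comparison)
      have "norm ((max 0 h)\<^sup>2 / h) \<le> \<bar>h\<bar>" for h :: real
        by (auto simp: max_def power2_eq_square)
      thus "\<forall>\<^sub>F h in at (0::real). norm ((max 0 h)\<^sup>2 / h) \<le> \<bar>h\<bar>" by simp
      show "((\<lambda>h. \<bar>h\<bar>) \<longlongrightarrow> 0) (at (0::real))"
        by (intro tendsto_rabs_zero tendsto_ident_at)
    qed
    thus ?thesis using 3 by (simp add: DERIV_def)
  qed
qed

lemma bump_derivative: "(bump has_real_derivative bump' t) (at t)"
proof -
  have "((\<lambda>t. (t - 1) * (4 - t)) has_real_derivative (5 - 2 * t)) (at t)"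
    by (auto intro!: derivative_eq_intros)
  from DERIV_chain2[OF has_real_derivative_max_0_squared this]
  show ?thesis by (simp add: bump_def[abs_def] bump'_def)
qed

lemma bump'_continuous: "continuous_on UNIV bump'"
  unfolding bump'_def[abs_def] by (intro continuous_intros)

lemma bump_nonneg: "0 \<le> bump t" by (simp add: bump_def)

lemma bump_eq_0: "t \<ge> 2\<^sup>2 \<Longrightarrow> bump t = 0"
  by (auto simp: bump_def max_def mult_le_0_iff zero_le_mult_iff)

lemma bump_pos_iff: "0 < bump ((norm v)\<^sup>2) \<longleftrightarrow> 1 < norm v \<and> norm v < 2"
proof -
  have "0 < bump ((norm v)\<^sup>2) \<longleftrightarrow> 0 < ((norm v)\<^sup>2 - 1) * (4 - (norm v)\<^sup>2)"
  proof -
    have "0 < (max 0 x)\<^sup>2 \<longleftrightarrow> 0 < x" for x :: real by (auto simp: max_def)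
    thus ?thesis unfolding bump_def .
  qed
  also have "\<dots> \<longleftrightarrow> 1 < (norm v)\<^sup>2 \<and> (norm v)\<^sup>2 < 2\<^sup>2"
    by (auto simp: zero_less_mult_iff)
  also have "\<dots> \<longleftrightarrow> 1 < norm v \<and> norm v < 2"
    using power_mono_iff[of "norm v" 1 2] power_mono_iff[of 2 "norm v" 2]
    by (simp add: not_le[symmetric])
  finally show ?thesis .
qed

section \<open>Removal of the regularisation and vanishing of the field\<close>

context tangent_field
begin

text \<open>The fraction \<epsilon> / (|f|^2 + \<epsilon>) stays in [0, 1] and tends to 0 off the
  zero set of \<open>f\<close>, so the term with \<open>S\<close> disappears by dominated
  convergence. The majorant is a constant times the unregularised weight; the singularities of the
  curve enter through its integrability.\<close>

lemma stokes_limit: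
  assumes \<psi>: "\<And>v. wirtinger \<psi> (A v) (B v) v"
    and cA: "\<And>k. continuous_on UNIV (\<lambda>v. A v k)" and cB: "\<And>k. continuous_on UNIV (\<lambda>v. B v k)"
    and \<phi>: "\<And>t. (\<phi> has_real_derivative \<phi>' t) (at t)" and c\<phi>': "continuous_on UNIV \<phi>'"
    and supp: "\<And>t. t \<ge> R\<^sup>2 \<Longrightarrow> \<phi> t = 0" and R: "0 \<le> R" and s: "0 \<le> s"
    and int: "integrable lborel (\<lambda>v. \<phi> ((norm v)\<^sup>2) * (cmod (f v))\<^sup>2 powr (- s))"
    and f_AE: "AE v in lborel. f v \<noteq> 0"
  defines "H \<equiv> \<lambda>v. (\<Sum>k\<in>UNIV. A v k * P k v) + \<psi> v * (N v * L v)"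
  shows "integrable lborel (\<lambda>v. of_real (\<phi> ((norm v)\<^sup>2) * (cmod (f v))\<^sup>2 powr (- s)) * H v)"
    and "(LBINT v. of_real (\<phi> ((norm v)\<^sup>2) * (cmod (f v))\<^sup>2 powr (- s)) * H v) = 0"
proof -
  define \<epsilon> where "\<epsilon> n = inverse (real (Suc n))" for n
  have \<epsilon>: "\<epsilon> n > 0" for n by (simp add: \<epsilon>_def)
  have \<epsilon>_lim: "\<epsilon> \<longlonglongrightarrow> 0" unfolding \<epsilon>_def by (rule LIMSEQ_inverse_real_of_nat)
  define w where "w v = \<phi> ((norm v)\<^sup>2) * (cmod (f v))\<^sup>2 powr (- s)" for v
  define q where "q n v = s * real d * (\<epsilon> n / ((cmod (f v))\<^sup>2 + \<epsilon> n))" for n v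
  define U where "U n v = of_real (\<phi> ((norm v)\<^sup>2) * W (\<epsilon> n) v) *
      (H v - \<psi> v * of_real (q n v) * S v)" for n v
  have U0: "integral\<^sup>L lborel (U n) = 0" for n
    using stokes_identity[OF \<psi> cA cB \<phi> c\<phi>' supp R \<epsilon>[of n]]
    by (simp add: U_def[abs_def] H_def q_def algebra_simps)
  have c\<phi>: "continuous_on UNIV (\<lambda>v::complex^'n. \<phi> ((norm v)\<^sup>2))"
  proof -
    have "continuous_on UNIV \<phi>"
      using \<phi> by (meson DERIV_isCont continuous_at_imp_continuous_on)
    thus ?thesis
      by (rule continuous_on_compose2) (intro continuous_intros, simp)
  qed
  have c\<psi>: "continuous_on UNIV \<psi>"
    using \<psi> wirtinger_imp_isCont by (meson continuous_at_imp_continuous_on)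
  have cH: "continuous_on UNIV H"
    unfolding H_def by (intro continuous_intros cA c\<psi> cont_P cont_N cont_L)
  have cq: "continuous_on UNIV (q n)" for n
    unfolding q_def using \<epsilon>[of n]
    by (intro continuous_intros cont_f) (simp add: add_nonneg_eq_0_iff)
  have cU: "continuous_on UNIV (U n)" for n
    unfolding U_def by (intro continuous_intros c\<phi> cont_W \<epsilon> cH c\<psi> cq cont_S)
  obtain M where M: "norm (H v) + norm (\<psi> v) * (s * real d) * norm (S v) \<le> M" if "norm v \<le> R" for v
  proof -
    have "bounded ((\<lambda>v. norm (H v) + norm (\<psi> v) * (s * real d) * norm (S v)) ` cball 0 R)"
      by (intro compact_imp_bounded compact_continuous_image continuous_intros
          continuous_on_subset[OF cH] continuous_on_subset[OF c\<psi>] continuous_on_subset[OF cont_S]) auto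
    then obtain M where "\<forall>v\<in>cball 0 R. norm (norm (H v) + norm (\<psi> v) * (s * real d) * norm (S v)) \<le> M"
      unfolding bounded_iff by blast
    thus thesis by (intro that[of M]) (auto simp: abs_le_iff)
  qed
  have q: "0 \<le> q n v" "q n v \<le> s * real d" for n v
  proof -
    have "0 \<le> \<epsilon> n / ((cmod (f v))\<^sup>2 + \<epsilon> n)" "\<epsilon> n / ((cmod (f v))\<^sup>2 + \<epsilon> n) \<le> 1"
      using \<epsilon>[of n] by (auto simp: divide_le_eq_1 add_nonneg_pos)
    moreover have "0 \<le> s * real d" using s by simp
    ultimately show "0 \<le> q n v" and "q n v \<le> s * real d"
      unfolding q_def using mult_nonneg_nonneg mult_left_le by blast+
  qed
  \<comment> \<open>At a zero of \<open>f\<close> the bound may fail: there \<open>w\<close> is 0 by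
    the convention on \<open>powr\<close>, while the regularised weight is positive.\<close>
  have bound: "norm (U n v) \<le> M * \<bar>w v\<bar>" if "f v \<noteq> 0" for n v
  proof (cases "norm v \<le> R")
    case True
    have "norm (H v - \<psi> v * of_real (q n v) * S v) \<le> norm (H v) + norm (\<psi> v) * q n v * norm (S v)"
      using norm_triangle_ineq4[of "H v" "\<psi> v * of_real (q n v) * S v"] q[of n v] by (simp add: norm_mult)
    also have "\<dots> \<le> norm (H v) + norm (\<psi> v) * (s * real d) * norm (S v)"
      using q[of n v] by (intro add_left_mono mult_right_mono mult_left_mono) auto
    also have "\<dots> \<le> M" using M True .
    finally have 1: "norm (H v - \<psi> v * of_real (q n v) * S v) \<le> M" .
    have "W (\<epsilon> n) v \<le> (cmod (f v))\<^sup>2 powr (- s)"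
      unfolding W_def using that s \<epsilon>[of n] by (intro powr_mono2') auto
    hence 2: "\<bar>\<phi> ((norm v)\<^sup>2) * W (\<epsilon> n) v\<bar> \<le> \<bar>w v\<bar>"
      by (simp add: w_def abs_mult W_def mult_left_mono)
    have "norm (U n v) = \<bar>\<phi> ((norm v)\<^sup>2) * W (\<epsilon> n) v\<bar> * norm (H v - \<psi> v * of_real (q n v) * S v)"
      by (simp add: U_def norm_mult abs_mult)
    also have "\<dots> \<le> \<bar>w v\<bar> * M"
      using 1 2 by (intro mult_mono) auto
    finally show ?thesis by (simp add: mult.commute)
  next
    case False
    hence "\<phi> ((norm v)\<^sup>2) = 0" using R by (intro supp power_mono) auto
    thus ?thesis by (simp add: U_def w_def)
  qed
  have lim: "(\<lambda>n. U n v) \<longlonglongrightarrow> of_real (w v) * H v" if "f v \<noteq> 0" for v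
  proof -
    have "(\<lambda>n. U n v) \<longlonglongrightarrow> of_real (\<phi> ((norm v)\<^sup>2) * ((cmod (f v))\<^sup>2 + 0) powr (- s)) *
        (H v - \<psi> v * of_real (s * real d * (0 / ((cmod (f v))\<^sup>2 + 0))) * S v)"
      unfolding U_def W_def q_def using that by (intro tendsto_intros \<epsilon>_lim) auto
    thus ?thesis by (simp add: w_def)
  qed
  have mw: "(\<lambda>v. of_real (w v) * H v) \<in> borel_measurable lborel"
  proof -
    have "w \<in> borel_measurable lborel"
      using int unfolding w_def by (rule borel_measurable_integrable)
    moreover have "H \<in> borel_measurable lborel"
      using cH by (simp add: borel_measurable_continuous_onI)
    ultimately show ?thesis by measurable
  qed
  have mU: "U n \<in> borel_measurable lborel" for n
    using cU by (simp add: borel_measurable_continuous_onI)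
  have wi: "integrable lborel (\<lambda>v. M * \<bar>w v\<bar>)"
    using int by (simp add: w_def[abs_def])
  have AE1: "AE v in lborel. (\<lambda>n. U n v) \<longlonglongrightarrow> of_real (w v) * H v"
    using f_AE lim by (auto elim: eventually_mono)
  have AE2: "AE v in lborel. norm (U n v) \<le> M * \<bar>w v\<bar>" for n
    using f_AE bound by (auto elim: eventually_mono)
  show "integrable lborel (\<lambda>v. of_real (\<phi> ((norm v)\<^sup>2) * (cmod (f v))\<^sup>2 powr (- s)) * H v)"
    using integrable_dominated_convergence[OF mw mU wi AE1 AE2] by (simp add: w_def[abs_def])
  have "(\<lambda>n. integral\<^sup>L lborel (U n)) \<longlonglongrightarrow> (LBINT v. of_real (w v) * H v)"
    by (rule integral_dominated_convergence[OF mw mU wi AE1 AE2])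
  thus "(LBINT v. of_real (\<phi> ((norm v)\<^sup>2) * (cmod (f v))\<^sup>2 powr (- s)) * H v) = 0"
    unfolding U0 by (simp add: LIMSEQ_const_iff w_def[abs_def])
qed

text \<open>A nonnegative integrand with integral zero vanishes almost everywhere, hence so does
  \<open>H\<close> where the cutoff is positive, and continuity removes the exceptional set. The
  real function \<open>h\<close> serves to state the positivity of the complex-valued
  \<open>H\<close>.\<close>

lemma stokes_vanishing:
  assumes \<psi>: "\<And>v. wirtinger \<psi> (A v) (B v) v"
    and cA: "\<And>k. continuous_on UNIV (\<lambda>v. A v k)" and cB: "\<And>k. continuous_on UNIV (\<lambda>v. B v k)"
    and \<phi>: "\<And>t. (\<phi> has_real_derivative \<phi>' t) (at t)" and c\<phi>': "continuous_on UNIV \<phi>'"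
    and supp: "\<And>t. t \<ge> R\<^sup>2 \<Longrightarrow> \<phi> t = 0" and R: "0 \<le> R" and s: "0 \<le> s"
    and int: "integrable lborel (\<lambda>v. \<phi> ((norm v)\<^sup>2) * (cmod (f v))\<^sup>2 powr (- s))"
    and f_AE: "AE v in lborel. f v \<noteq> 0"
  defines "H \<equiv> \<lambda>v. (\<Sum>k\<in>UNIV. A v k * P k v) + \<psi> v * (N v * L v)"
  assumes \<phi>0: "\<And>t. 0 \<le> \<phi> t"
    and H: "\<And>v. \<phi> ((norm v)\<^sup>2) > 0 \<Longrightarrow> H v = of_real (h v) \<and> 0 \<le> h v"
    and v: "\<phi> ((norm v)\<^sup>2) > 0"
  shows "h v = 0"
proof -
  define w where "w v = \<phi> ((norm v)\<^sup>2) * (cmod (f v))\<^sup>2 powr (- s)" for v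
  have lim: "integrable lborel (\<lambda>v. of_real (w v) * H v)"
    "(LBINT v. of_real (w v) * H v) = 0"
    unfolding H_def w_def
    using stokes_limit[OF \<psi> cA cB \<phi> c\<phi>' supp R s int f_AE] by simp_all
  have w0: "0 \<le> w v" for v by (simp add: w_def \<phi>0)
  have wH: "of_real (w v) * H v = of_real (w v * Re (H v))" and wRe: "0 \<le> w v * Re (H v)" for v
    using H[of v] \<phi>0[of "(norm v)\<^sup>2"] w0[of v]
    by (cases "\<phi> ((norm v)\<^sup>2) = 0"; simp add: w_def)+
  have "integrable lborel (\<lambda>v. w v * Re (H v))"
    using integrable_Re[OF lim(1)] unfolding wH by simp
  moreover have "(LBINT v. w v * Re (H v)) = 0"
    using lim(2) unfolding wH integral_complex_of_real by (simp only: of_real_eq_0_iff)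
  ultimately have "AE v in lborel. w v * Re (H v) = 0"
    by (subst (asm) integral_nonneg_eq_0_iff_AE) (auto simp: wRe)
  with f_AE have "AE v in lborel. v \<notin> {v. \<phi> ((norm v)\<^sup>2) > 0 \<and> Re (H v) > 0}"
    by eventually_elim (auto simp: w_def)
  moreover have "open {v. \<phi> ((norm v)\<^sup>2) > 0 \<and> Re (H v) > 0}"
  proof -
    have "continuous_on UNIV (\<lambda>v::complex^'n. \<phi> ((norm v)\<^sup>2))"
    proof -
      have "continuous_on UNIV \<phi>"
        using \<phi> by (meson DERIV_isCont continuous_at_imp_continuous_on)
      thus ?thesis
        by (rule continuous_on_compose2) (intro continuous_intros, simp)
    qed
    moreover have "continuous_on UNIV (\<lambda>v. Re (H v))"
    proof -
      have "continuous_on UNIV \<psi>"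
        using \<psi> wirtinger_imp_isCont by (meson continuous_at_imp_continuous_on)
      thus ?thesis
        unfolding H_def by (intro continuous_intros cA cont_P cont_N cont_L)
    qed
    ultimately show ?thesis
      by (intro open_Collect_conj open_Collect_less continuous_on_const)
  qed
  ultimately have "{v. \<phi> ((norm v)\<^sup>2) > 0 \<and> Re (H v) > 0} = {}"
    by (intro open_null_set_empty)
  moreover have "Re (H v) = h v" "0 \<le> h v" using H[OF v] by auto
  ultimately show ?thesis using v by fastforce
qed

text \<open>Applying the identity to \<open>\<psi> = cnj L\<close> shows that \<open>T\<close> is divergence free, and then applying
  it to the Hermitian product of \<open>v\<close> and \<open>T\<close> shows that \<open>T\<close> is radial.\<close>

theorem tangent_field_vanishes:
  assumes L: "\<And>v. wirtinger L (DL v) (\<lambda>_. 0) v" and cDL: "\<And>k. continuous_on UNIV (\<lambda>v. DL v k)"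
    and s: "0 \<le> s" and d: "0 < d"
    and int: "integrable lborel (\<lambda>v. bump ((norm v)\<^sup>2) * (cmod (f v))\<^sup>2 powr (- s))"
    and f_AE: "AE v in lborel. f v \<noteq> 0"
    and v: "1 < norm v" "norm v < 2"
  shows "T i v = 0"
proof -
  note van = stokes_vanishing[where R = 2, OF _ _ _ bump_derivative bump'_continuous bump_eq_0 _ s int f_AE bump_nonneg]
  \<comment> \<open>\<open>L\<close> is holomorphic, so its conjugate has no derivatives with
    respect to the coordinates: the sum with \<open>P\<close> drops out and N |L|^2 remains.\<close>
  have L0: "L v = 0" if "1 < norm v" "norm v < 2" for v
  proof -
    have "(norm v)\<^sup>2 * (cmod (L v))\<^sup>2 = 0"
    proof (rule van[where \<psi> = "\<lambda>v. cnj (L v)" and A = "\<lambda>_ _. 0" and B = "\<lambda>v k. cnj (DL v k)" and h = "\<lambda>v. (norm v)\<^sup>2 * (cmod (L v))\<^sup>2"])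
      show "wirtinger (\<lambda>v. cnj (L v)) (\<lambda>_. 0) (\<lambda>k. cnj (DL v k)) v" for v
        using wirtinger_cnj[OF L] by simp
      show "continuous_on UNIV (\<lambda>v. cnj (DL v k))" for k
        by (intro continuous_intros cDL)
      show "(\<Sum>k\<in>UNIV. 0 * P k v) + cnj (L v) * (N v * L v) =
          of_real ((norm v)\<^sup>2 * (cmod (L v))\<^sup>2) \<and> 0 \<le> (norm v)\<^sup>2 * (cmod (L v))\<^sup>2" for v
      proof -
        have "cnj (L v) * (N v * L v) = N v * (L v * cnj (L v))" by simp
        also have "\<dots> = of_real ((norm v)\<^sup>2 * (cmod (L v))\<^sup>2)"
          by (simp only: N_eq of_real_mult complex_norm_square)
        finally show ?thesis by simp
      qed
      show "0 < bump ((norm v)\<^sup>2)" using that by (simp add: bump_pos_iff)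
    qed simp_all
    thus ?thesis using that by auto
  qed
  \<comment> \<open>The test function is the conjugate of \<open>S\<close>, with coordinate
    derivatives \<open>cnj (T k v)\<close>. Since \<open>P\<close> is orthogonal to the radial
    vector, pairing it with \<open>T\<close> gives |P|^2 / N, and the divergence term is gone by
    \<open>L0\<close>.\<close>
  have P0: "P k v = 0" if "1 < norm v" "norm v < 2" for k v
  proof -
    define h where "h v = (\<Sum>k\<in>UNIV. (cmod (P k v))\<^sup>2) / (norm v)\<^sup>2" for v
    have "h v = 0"
    proof (rule van[where \<psi> = "\<lambda>v. \<Sum>j\<in>UNIV. v $ j * cnj (T j v)" and A = "\<lambda>v k. cnj (T k v)"
          and B = "\<lambda>v k. \<Sum>j\<in>UNIV. v $ j * cnj (DT j v k)" and h = h])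
      show "wirtinger (\<lambda>v. \<Sum>j\<in>UNIV. v $ j * cnj (T j v)) (\<lambda>k. cnj (T k v))
          (\<lambda>k. \<Sum>j\<in>UNIV. v $ j * cnj (DT j v k)) v" for v
        by (rule wirtinger_eq_rhs, rule wirtinger_sum, rule wirtinger_mult,
            rule wirtinger_vec_nth, rule wirtinger_cnj, rule T)
          (simp_all add: if_distrib[of "\<lambda>x. x * _"] cong: if_cong)
      show "continuous_on UNIV (\<lambda>v. cnj (T k v))" for k
        by (intro continuous_intros cont_T)
      show "continuous_on UNIV (\<lambda>v. \<Sum>j\<in>UNIV. v $ j * cnj (DT j v k))" for k
        by (intro continuous_intros cont_DT)
      show "(\<Sum>k\<in>UNIV. cnj (T k v) * P k v) + (\<Sum>j\<in>UNIV. v $ j * cnj (T j v)) * (N v * L v) =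
          of_real (h v) \<and> 0 \<le> h v" if "0 < bump ((norm v)\<^sup>2)" for v
      proof -
        have nv: "1 < norm v" "norm v < 2" using that by (simp_all add: bump_pos_iff)
        have "of_real (\<Sum>k\<in>UNIV. (cmod (P k v))\<^sup>2) = (\<Sum>k\<in>UNIV. cnj (P k v) * P k v)"
          unfolding of_real_sum complex_norm_square by (simp add: mult.commute)
        also have "\<dots> = cnj (N v) * (\<Sum>k\<in>UNIV. cnj (T k v) * P k v) - cnj (S v) * (\<Sum>k\<in>UNIV. cnj (v $ k) * P k v)"
          unfolding P_def[of _ v] complex_cnj_diff complex_cnj_mult left_diff_distrib sum_subtractf sum_distrib_left
          by (simp add: mult_ac)
        also have "\<dots> = of_real ((norm v)\<^sup>2) * (\<Sum>k\<in>UNIV. cnj (T k v) * P k v)"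
          by (simp only: sum_P_radial N_eq complex_cnj_complex_of_real) simp
        finally have "(\<Sum>k\<in>UNIV. cnj (T k v) * P k v) = of_real (h v)"
          using nv by (auto simp: h_def field_simps)
        moreover have "0 \<le> h v" unfolding h_def by (intro divide_nonneg_nonneg sum_nonneg) auto
        ultimately show ?thesis using L0[OF nv] by simp
      qed
      show "0 < bump ((norm v)\<^sup>2)" using that by (simp add: bump_pos_iff)
    qed simp_all
    hence "(\<Sum>k\<in>UNIV. (cmod (P k v))\<^sup>2) = 0" using that by (auto simp: h_def)
    thus ?thesis by (simp add: sum_nonneg_eq_0_iff)
  qed
  \<comment> \<open>Once \<open>P\<close> vanishes, d S f = 0. Off the zeros of \<open>f\<close>
    this kills \<open>S\<close> and then N T = P + S v; continuity extends the conclusion to the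
    zeros.\<close>
  have T0: "T k v = 0" if v: "1 < norm v" "norm v < 2" and fv: "f v \<noteq> 0" for k v
  proof -
    have "S v * of_nat d * f v = 0"
      using sum_P_Df[of v] P0[OF v] by simp
    hence "S v = 0" using fv d by simp
    hence "N v * T k v = 0" using P0[OF v, of k] by (simp add: P_def)
    thus ?thesis using v by (auto simp: N_eq)
  qed
  have "AE v in lborel. v \<notin> {v. 1 < norm v \<and> norm v < 2 \<and> T i v \<noteq> 0}"
    using f_AE by eventually_elim (use T0 in auto)
  moreover have "open {v. 1 < norm v \<and> norm v < 2 \<and> T i v \<noteq> 0}"
    by (intro open_Collect_conj open_Collect_less open_Collect_neq continuous_intros cont_T)
  ultimately have "{v. 1 < norm v \<and> norm v < 2 \<and> T i v \<noteq> 0} = {}"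
    by (intro open_null_set_empty)
  thus ?thesis using v by blast
qed

end

section \<open>Lines\<close>

lemma vec_nth_vec_lambda: "vec_nth (vec_lambda g) = g"
  by (simp add: fun_eq_iff)

lemma linear_form_imp_linform:
  assumes "linear_form l"
  obtains a :: "complex^3" where "a \<noteq> 0" and "\<And>v. evaluate l (vec_nth v) = linform a v"
proof -
  define a :: "complex^3" where "a = (\<chi> i. Poly_Mapping.lookup l (Poly_Mapping.single i 1))"
  have e: "evaluate l (vec_nth v) = linform a v" for v
    using assms by (simp add: linear_form_def evaluate_linear linform_def a_def)
  obtain v where "evaluate l v \<noteq> 0"
    using assms evaluate_not_identically_0 by (auto simp: linear_form_def)
  hence "linform a (vec_lambda v) \<noteq> 0"
    by (simp flip: e add: vec_nth_vec_lambda)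
  hence "a \<noteq> 0" by (auto simp: linform_def)
  with e show thesis using that by blast
qed

definition span_point :: "complex^3 \<Rightarrow> point" where
  "span_point v = range (\<lambda>c i. c * v $ i)"

lemma span_point_in_proj_plane: "v \<noteq> 0 \<Longrightarrow> span_point v \<in> proj_plane"
  unfolding proj_plane_def span_point_def by (force simp: vec_eq_iff fun_eq_iff)

lemma proj_plane_eq: "P \<in> proj_plane \<Longrightarrow> \<exists>v. v \<noteq> 0 \<and> P = span_point v"
proof -
  assume "P \<in> proj_plane"
  then obtain v where v: "v \<noteq> (\<lambda>i. 0)" "P = range (\<lambda>c i. c * v i)"
    unfolding proj_plane_def by blast
  hence "vec_lambda v \<noteq> (0 :: complex^3)" by (auto simp: vec_eq_iff fun_eq_iff)
  thus ?thesis using v by (intro exI[of _ "vec_lambda v"]) (simp add: span_point_def)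
qed

lemma span_point_in_zero_locus:
  assumes "linear_form l" "v \<noteq> 0"
  shows "span_point v \<in> zero_locus l \<longleftrightarrow> evaluate l (vec_nth v) = 0"
proof -
  have "evaluate l (\<lambda>i. c * v $ i) = c * evaluate l (vec_nth v)" for c
    using assms evaluate_homogeneous[of 1 l c "vec_nth v"] by (simp add: linear_form_def)
  thus ?thesis
    using span_point_in_proj_plane[OF assms(2)]
    by (auto simp: zero_locus_def span_point_def)
qed

lemma linform_axis: "linform a (axis i c) = a $ i * c"
  by (simp add: linform_def axis_def if_distrib cong: if_cong)

text \<open>The vectors with entry \<open>a' $ i\<close> in place \<open>j\<close> and entry
  \<open>- a' $ j\<close> in place \<open>i\<close> lie in the kernel of \<open>a'\<close>.
  Evaluating \<open>a\<close> on them gives proportionality entry by entry.\<close>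

lemma linform_proportional:
  fixes a a' :: "complex^'n"
  assumes "a' \<noteq> 0" and ker: "\<And>e. linform a' e = 0 \<Longrightarrow> linform a e = 0"
  obtains c where "a = c *s a'"
proof -
  obtain i where i: "a' $ i \<noteq> 0" using assms(1) by (auto simp: vec_eq_iff)
  have "a $ j = a $ i / a' $ i * a' $ j" for j
  proof -
    have "linform b (axis j (a' $ i) + axis i (- a' $ j)) = b $ j * a' $ i - b $ i * a' $ j" for b
      by (simp add: linform_add linform_axis)
    from ker[of "axis j (a' $ i) + axis i (- a' $ j)"] this[of a] this[of a']
    show ?thesis using i by (simp add: field_simps)
  qed
  hence "a = (a $ i / a' $ i) *s a'"
    unfolding vec_eq_iff vector_smult_component by blast
  thus thesis by (rule that)
qed

text \<open>Without such a vector one form would be a nonzero multiple of the other and the lines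
  would agree. The vector serves as a direction of integration for one form along which the other is
  constant.\<close>

lemma distinct_lines_separated:
  assumes l: "linear_form l" "linear_form l'" and ne: "zero_locus l \<noteq> zero_locus l'"
    and a: "a \<noteq> 0" "\<And>v. evaluate l (vec_nth v) = linform a v"
    and a': "a' \<noteq> 0" "\<And>v. evaluate l' (vec_nth v) = linform a' v"
  shows "\<exists>e. linform a e = 1 \<and> linform a' e = 0"
proof (rule ccontr)
  assume neg: "\<not> ?thesis"
  have "linform a e = 0" if "linform a' e = 0" for e
  proof (rule ccontr)
    assume "linform a e \<noteq> 0"
    hence "linform a (inverse (linform a e) *s e) = 1 \<and> linform a' (inverse (linform a e) *s e) = 0"
      using that by (simp add: linform_smult)
    thus False using neg by blast
  qed
  then obtain c where c: "a = c *s a'"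
    using linform_proportional[OF a'(1)] by blast
  hence "c \<noteq> 0" using a(1) by auto
  have "linform a v = c * linform a' v" for v
    unfolding c by (simp add: linform_def sum_distrib_left mult_ac)
  hence "span_point v \<in> zero_locus l \<longleftrightarrow> span_point v \<in> zero_locus l'" if "v \<noteq> 0" for v
    using span_point_in_zero_locus[OF l(1) that] span_point_in_zero_locus[OF l(2) that]
      \<open>c \<noteq> 0\<close> a(2) a'(2) by simp
  hence "P \<in> zero_locus l \<longleftrightarrow> P \<in> zero_locus l'" if "P \<in> proj_plane" for P
    using proj_plane_eq[OF that] by auto
  moreover have "P \<in> proj_plane" if "P \<in> zero_locus m" for P m
    using that by (simp add: zero_locus_def)
  ultimately have "zero_locus l = zero_locus l'" by blast
  with ne show False by blast
qed

text \<open>The maximum ranges over intersection points only; at most one line passes through any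
  other point, which \<open>1 \<le> m\<close> covers.\<close>

lemma card_lines_through_le:
  assumes "finite \<L>" and "max_multiplicity \<L> \<le> m" and "1 \<le> m"
  shows "card {L \<in> \<L>. P \<in> L} \<le> m"
proof (cases "P \<in> intersection_points \<L>")
  case True
  have "multiplicity_at \<L> ` intersection_points \<L> \<subseteq> {..card \<L>}"
    using assms(1) by (auto simp: multiplicity_at_def intro!: card_mono)
  hence "multiplicity_at \<L> P \<le> max_multiplicity \<L>"
    unfolding max_multiplicity_def using True by (intro Max_ge) (auto intro: finite_subset)
  thus ?thesis using assms(2) by (simp add: multiplicity_at_def)
next
  case False
  have "L = L'" if "L \<in> \<L>" "P \<in> L" "L' \<in> \<L>" "P \<in> L'" for L L'
    using that False by (auto simp: intersection_points_def)
  hence "card {L \<in> \<L>. P \<in> L} \<le> 1"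
    using card_le_Suc0_iff_eq[of "{L \<in> \<L>. P \<in> L}"] assms(1) by auto
  thus ?thesis using assms(3) by simp
qed

section \<open>Homogeneous polynomials\<close>

lemma homogeneous_sum: "(\<And>a. a \<in> A \<Longrightarrow> homogeneous n (p a)) \<Longrightarrow> homogeneous n (\<Sum>a\<in>A. p a)"
  unfolding homogeneous_def using keys_sum[of p A] by blast

lemma homogeneous_mult:
  assumes "homogeneous m p" "homogeneous n q"
  shows "homogeneous (m + n) (p * q)"
  unfolding homogeneous_def
proof
  fix k assume "k \<in> Poly_Mapping.keys (p * q)"
  then obtain a b where "a \<in> Poly_Mapping.keys p" "b \<in> Poly_Mapping.keys q" "k = a + b"
    using keys_mult[of p q] by blast
  thus "(\<Sum>i\<in>UNIV. int (Poly_Mapping.lookup k i)) = m + n"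
    using assms by (simp add: homogeneous_def Poly_Mapping.lookup_add sum.distrib)
qed

lemma homogeneous_const: "homogeneous 0 (Poly_Mapping.single 0 c)"
  by (simp add: homogeneous_def)

lemma homogeneous_prod:
  "(\<And>a. a \<in> A \<Longrightarrow> homogeneous n (p a)) \<Longrightarrow> homogeneous (int (card A) * n) (\<Prod>a\<in>A. p a)"
proof (induction A rule: infinite_finite_induct)
  case (insert a A)
  hence "homogeneous (n + int (card A) * n) (p a * (\<Prod>a\<in>A. p a))"
    by (intro homogeneous_mult) auto
  with insert show ?case by (simp add: distrib_right)
qed (use homogeneous_const[of 1] in auto)

text \<open>In a combination of forms of equal degree only the constant terms of the coefficients count:
  compare both sides at \<open>t *s v\<close> and let \<open>t\<close> tend to zero.\<close>

lemma homogeneous_combination_constants: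
  fixes v :: "complex^3"
  assumes p: "homogeneous (int n) p" and r: "\<And>i. i \<in> I \<Longrightarrow> homogeneous (int n) (r i)"
    and eq: "p = (\<Sum>i\<in>I. q i * r i)"
  shows "evaluate p (vec_nth v) =
    (\<Sum>i\<in>I. Poly_Mapping.lookup (q i) 0 * evaluate (r i) (vec_nth v))"
proof -
  define F where "F t = (\<Sum>i\<in>I. evaluate (q i) (\<lambda>j. t * v $ j) * evaluate (r i) (vec_nth v))" for t
  have "F t = evaluate p (vec_nth v)" if "t \<noteq> 0" for t
  proof -
    have "t ^ n * evaluate p (vec_nth v) = evaluate p (\<lambda>j. t * v $ j)"
      using evaluate_homogeneous[OF p] by simp
    also have "\<dots> = t ^ n * F t"
      by (simp add: eq F_def evaluate_homogeneous[OF r] sum_distrib_left mult_ac)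
    finally show ?thesis using that by simp
  qed
  hence "((\<lambda>t. F t) \<longlongrightarrow> evaluate p (vec_nth v)) (at 0)"
    by (intro tendsto_eventually) (auto simp: eventually_at_filter)
  moreover have "continuous_on UNIV F"
    unfolding F_def by (intro continuous_intros)
  hence "(F \<longlongrightarrow> F 0) (at 0)"
    by (simp add: continuous_on_eq_continuous_at isCont_def)
  ultimately have "evaluate p (vec_nth v) = F 0"
    using tendsto_unique by (metis at_neq_bot)
  thus ?thesis by (simp add: F_def evaluate_at_0)
qed

section \<open>The syzygy of lowest degree\<close>

lemma module_poly3: "module ((*) :: poly3 \<Rightarrow> poly3 \<Rightarrow> poly3)"
  by unfold_locales (simp_all add: algebra_simps)

lemma jacobian_idealD:
  assumes "p \<in> jacobian_ideal f"
  shows "\<exists>q. p = (\<Sum>i\<in>UNIV. q i * partial_deriv i f)"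
proof -
  interpret m: module "(*) :: poly3 \<Rightarrow> poly3 \<Rightarrow> poly3" by (rule module_poly3)
  let ?T = "{p. \<exists>q. p = (\<Sum>i\<in>UNIV. q i * partial_deriv i f)}"
  have "m.subspace ?T"
  proof (rule m.subspaceI)
    show "0 \<in> ?T" by (auto intro!: exI[of _ "\<lambda>_. 0"])
    show "x + y \<in> ?T" if "x \<in> ?T" "y \<in> ?T" for x y
    proof -
      from that obtain q q' where xy: "x = (\<Sum>i\<in>UNIV. q i * partial_deriv i f)"
        "y = (\<Sum>i\<in>UNIV. q' i * partial_deriv i f)" by blast
      have "x + y = (\<Sum>i\<in>UNIV. (q i + q' i) * partial_deriv i f)"
        unfolding xy by (simp only: distrib_right sum.distrib)
      thus ?thesis by (intro CollectI exI)
    qed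
    show "c * x \<in> ?T" if "x \<in> ?T" for c x
    proof -
      from that obtain q where x: "x = (\<Sum>i\<in>UNIV. q i * partial_deriv i f)" by blast
      have "c * x = (\<Sum>i\<in>UNIV. (c * q i) * partial_deriv i f)"
        unfolding x by (simp only: sum_distrib_left mult.assoc)
      thus ?thesis by (intro CollectI exI)
    qed
  qed
  moreover have "range (\<lambda>i. partial_deriv i f) \<subseteq> ?T"
  proof (intro image_subsetI CollectI)
    fix j
    show "\<exists>q. partial_deriv j f = (\<Sum>i\<in>UNIV. q i * partial_deriv i f)"
      by (intro exI[of _ "\<lambda>i. if i = j then 1 else 0"])
        (simp add: if_distrib[of "\<lambda>x. x * _"] cong: if_cong)
  qed
  ultimately show ?thesis
    using m.span_minimal assms unfolding jacobian_ideal_def by blast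
qed

lemma partial_deriv_in_jacobian_ideal: "partial_deriv i f \<in> jacobian_ideal f"
proof -
  interpret m: module "(*) :: poly3 \<Rightarrow> poly3 \<Rightarrow> poly3" by (rule module_poly3)
  show ?thesis unfolding jacobian_ideal_def by (intro m.span_base) auto
qed

text \<open>Here \<open>g\<close> consists of the entries of \<open>\<phi>1\<close> and
  \<open>h\<close> is the first column of \<open>\<phi>2\<close>. Exactness makes \<open>h\<close> a
  relation among generators of the Jacobian ideal, and minimality makes it nonzero. The last bound
  is d1 \<le> d2 together with d1 + d2 = d.\<close>

lemma plus_one_generated_first_syzygy:
  assumes "plus_one_generated_curve d f d1 d2 d3"
  shows "\<exists>g h :: 3 \<Rightarrow> poly3.
    (\<forall>j. homogeneous (int d - 1) (g j) \<and> g j \<in> jacobian_ideal f) \<and>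
    (\<forall>i. \<exists>u. partial_deriv i f = (\<Sum>j\<in>UNIV. u j * g j)) \<and>
    (\<forall>j. homogeneous (int d1) (h j)) \<and> (\<Sum>j\<in>UNIV. h j * g j) = 0 \<and> (\<exists>j. h j \<noteq> 0)"
    and "1 \<le> d1" and "2 * d1 \<le> d"
proof -
  define F2 where "F2 = map (\<lambda>k. 1 - int d - int k) [d1, d2, d3]"
  define F1 where "F1 = replicate 3 (1 - int d)"
  from assms obtain es \<phi>3 \<phi>2 \<phi>1 where
    len: "length [d1, d2, d3] = length (es :: int list) + 2"
    and res: "minimal_graded_free_resolution (jacobian_ideal f) (map (\<lambda>e. - e) es) F2 F1 \<phi>3 \<phi>2 \<phi>1"
    and ds: "1 \<le> d1" "d1 \<le> d2" "d1 + d2 = d"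
    unfolding plus_one_generated_curve_def syzygy_curve_def F1_def F2_def by auto
  have c3: "\<phi>3 \<in> carrier_mat 3 (length es)" and c2: "\<phi>2 \<in> carrier_mat 3 3" and c1: "\<phi>1 \<in> carrier_mat 1 3"
    and h2: "\<And>i j. i < 3 \<Longrightarrow> j < 3 \<Longrightarrow> homogeneous (F1 ! i - F2 ! j) (\<phi>2 $$ (i, j))"
    and h1: "\<And>j. j < 3 \<Longrightarrow> homogeneous (0 - F1 ! j) (\<phi>1 $$ (0, j))"
    and k2: "mat_kernel \<phi>2 = mat_image \<phi>3" and k1: "mat_kernel \<phi>1 = mat_image \<phi>2"
    and im: "mat_image \<phi>1 = {v \<in> carrier_vec 1. vec_index v 0 \<in> jacobian_ideal f}"
    and irr: "elements_mat \<phi>3 \<subseteq> irrelevant_ideal"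
    using res unfolding minimal_graded_free_resolution_def graded_map_def F1_def F2_def by auto
  define idx :: "3 \<Rightarrow> nat" where "idx i = (if i = 0 then 0 else if i = 1 then 1 else 2)" for i
  have idx: "idx i < 3" for i by (simp add: idx_def)
  have sum_idx: "(\<Sum>j\<in>{0..<3}. F j) = (\<Sum>i\<in>UNIV. F (idx i))" for F :: "nat \<Rightarrow> poly3"
  proof -
    have "(3::3) = 0" by simp
    hence U: "(UNIV :: 3 set) = {0, 1, 2}" using UNIV_3 by auto
    have I: "{0..<3} = {0, 1, 2::nat}" by auto
    show ?thesis unfolding I U by (simp add: idx_def)
  qed
  have app1: "vec_index (\<phi>1 *\<^sub>v v) 0 = (\<Sum>i\<in>UNIV. vec_index v (idx i) * \<phi>1 $$ (0, idx i))"
    if "v \<in> carrier_vec 3" for v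
    using c1 that by (simp add: scalar_prod_def sum_idx mult.commute)
  define g where "g i = \<phi>1 $$ (0, idx i)" for i
  define h where "h i = \<phi>2 $$ (idx i, 0)" for i
  show "1 \<le> d1" "2 * d1 \<le> d" using ds by simp_all
  show "\<exists>g h :: 3 \<Rightarrow> poly3.
    (\<forall>j. homogeneous (int d - 1) (g j) \<and> g j \<in> jacobian_ideal f) \<and>
    (\<forall>i. \<exists>u. partial_deriv i f = (\<Sum>j\<in>UNIV. u j * g j)) \<and>
    (\<forall>j. homogeneous (int d1) (h j)) \<and> (\<Sum>j\<in>UNIV. h j * g j) = 0 \<and> (\<exists>j. h j \<noteq> 0)"
  proof (rule exI[of _ g], rule exI[of _ h], intro conjI allI)
    show "homogeneous (int d - 1) (g j)" for j
      using h1[OF idx[of j]] idx[of j] by (simp add: g_def F1_def)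
    show "homogeneous (int d1) (h j)" for j
      using h2[OF idx[of j], of 0] idx[of j] by (simp add: h_def F1_def F2_def)
    show "g j \<in> jacobian_ideal f" for j
    proof -
      have "\<phi>1 *\<^sub>v unit_vec 3 (idx j) \<in> mat_image \<phi>1"
        unfolding mat_image_def using c1 by auto
      hence "vec_index (\<phi>1 *\<^sub>v unit_vec 3 (idx j)) 0 \<in> jacobian_ideal f"
        unfolding im by simp
      also have "vec_index (\<phi>1 *\<^sub>v unit_vec 3 (idx j)) 0 = g j"
        using c1 idx[of j] by (simp add: g_def)
      finally show ?thesis .
    qed
    show "\<exists>u. partial_deriv i f = (\<Sum>j\<in>UNIV. u j * g j)" for i
    proof -
      have "Matrix.vec 1 (\<lambda>_. partial_deriv i f) \<in> mat_image \<phi>1"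
        unfolding im using partial_deriv_in_jacobian_ideal by simp
      then obtain v where v: "v \<in> carrier_vec 3" "Matrix.vec 1 (\<lambda>_. partial_deriv i f) = \<phi>1 *\<^sub>v v"
        unfolding mat_image_def using c1 by auto
      have "partial_deriv i f = vec_index (Matrix.vec 1 (\<lambda>_. partial_deriv i f)) 0" by simp
      also have "\<dots> = (\<Sum>j\<in>UNIV. vec_index v (idx j) * g j)"
        unfolding v(2) app1[OF v(1)] g_def ..
      finally show ?thesis by (rule exI[of _ "\<lambda>j. vec_index v (idx j)"])
    qed
    show "(\<Sum>j\<in>UNIV. h j * g j) = 0"
    proof -
      have "\<phi>2 *\<^sub>v unit_vec 3 0 \<in> mat_image \<phi>2"
        unfolding mat_image_def using c2 by auto
      hence "\<phi>2 *\<^sub>v unit_vec 3 0 \<in> mat_kernel \<phi>1" by (simp add: k1)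
      hence "\<phi>1 *\<^sub>v (\<phi>2 *\<^sub>v unit_vec 3 0) = 0\<^sub>v 1"
        using mat_kernelD(2)[OF c1] by blast
      hence "vec_index (\<phi>1 *\<^sub>v (\<phi>2 *\<^sub>v unit_vec 3 0)) 0 = 0" by simp
      moreover have "vec_index (\<phi>2 *\<^sub>v unit_vec 3 0) (idx i) = h i" for i
        using c2 idx[of i] by (simp add: h_def)
      ultimately show ?thesis
        using app1[of "\<phi>2 *\<^sub>v unit_vec 3 0"] c2 by (simp add: g_def)
    qed
    \<comment> \<open>A zero column would put the first unit vector into the kernel of
      \<open>\<phi>2\<close>, which is the image of \<open>\<phi>3\<close>. All entries of
      \<open>\<phi>3\<close> vanish at the origin, so its first coordinate 1 would be 0
      there.\<close>
    show "\<exists>j. h j \<noteq> 0"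
    proof (rule ccontr)
      assume "\<nexists>j. h j \<noteq> 0"
      hence h0: "h j = 0" for j by blast
      have "\<phi>2 $$ (i, 0) = 0" if "i < 3" for i
        using h0[of 0] h0[of 1] h0[of 2] that
        by (auto simp: h_def idx_def numeral_3_eq_3 numeral_2_eq_2 less_Suc_eq)
      hence "\<phi>2 *\<^sub>v unit_vec 3 0 = 0\<^sub>v 3"
        using c2 by (intro eq_vecI) auto
      hence "unit_vec 3 0 \<in> mat_kernel \<phi>2"
        using c2 by (auto simp: mat_kernel_def)
      then obtain u where u: "u \<in> carrier_vec (length es)" "unit_vec 3 0 = \<phi>3 *\<^sub>v u"
        unfolding k2 mat_image_def using c3 by auto
      have "(1 :: poly3) = vec_index (unit_vec 3 0) 0" by simp
      also have "\<dots> = vec_index (\<phi>3 *\<^sub>v u) 0" by (simp add: u(2))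
      also have "\<dots> = (\<Sum>j\<in>{0..<length es}. \<phi>3 $$ (0, j) * vec_index u j)"
        using c3 u(1) by (simp add: scalar_prod_def)
      finally have "1 = evaluate (\<Sum>j\<in>{0..<length es}. \<phi>3 $$ (0, j) * vec_index u j) (\<lambda>_. 0)"
        by (metis evaluate_one)
      also have "\<dots> = (\<Sum>j\<in>{0..<length es}. evaluate (\<phi>3 $$ (0, j)) (\<lambda>_. 0) * evaluate (vec_index u j) (\<lambda>_. 0))"
        by (simp only: evaluate_sum evaluate_mult)
      also have "\<dots> = 0"
      proof (rule sum.neutral, rule ballI)
        fix j assume "j \<in> {0..<length es}"
        hence "\<phi>3 $$ (0, j) \<in> elements_mat \<phi>3"
          using c3 by (intro elements_matI) auto
        hence "evaluate (\<phi>3 $$ (0, j)) (\<lambda>_. 0) = 0"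
          using irr by (auto simp: evaluate_at_0 irrelevant_ideal_def)
        thus "evaluate (\<phi>3 $$ (0, j)) (\<lambda>_. 0) * evaluate (vec_index u j) (\<lambda>_. 0) = 0" by simp
      qed
      finally show False by simp
    qed
  qed
qed

text \<open>The \<open>g j\<close> and the partial derivatives generate the same ideal and all have
  degree d - 1, so each family is a constant combination of the other, with matrices
  \<open>C\<close> and \<open>D\<close>. Independence of the partial derivatives makes these inverse
  to each other, and \<open>D\<close> turns the relation \<open>h\<close> into a derivation
  annihilating \<open>f\<close>.\<close>

lemma exists_tangent_derivation:
  assumes pog: "plus_one_generated_curve d f d1 d2 d3" and f: "homogeneous (int d) f" and d: "1 \<le> d"
    and indep: "\<And>y. (\<And>v. (\<Sum>i\<in>UNIV. y $ i * evaluate (partial_deriv i f) (vec_nth v)) = 0) \<Longrightarrow> y = 0"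
  shows "\<exists>\<theta> :: 3 \<Rightarrow> poly3. (\<forall>i. homogeneous (int d1) (\<theta> i)) \<and>
    (\<forall>v. (\<Sum>i\<in>UNIV. evaluate (\<theta> i) (vec_nth v) * evaluate (partial_deriv i f) (vec_nth v)) = 0) \<and>
    (\<exists>i v. evaluate (\<theta> i) (vec_nth v) \<noteq> 0)"
proof -
  obtain g h :: "3 \<Rightarrow> poly3" where g: "\<forall>j. homogeneous (int d - 1) (g j) \<and> g j \<in> jacobian_ideal f"
    and u: "\<forall>i. \<exists>u. partial_deriv i f = (\<Sum>j\<in>UNIV. u j * g j)"
    and h: "\<forall>j. homogeneous (int d1) (h j)" "(\<Sum>j\<in>UNIV. h j * g j) = 0" "\<exists>j. h j \<noteq> 0"
    using plus_one_generated_first_syzygy(1)[OF pog] by (elim exE conjE) (rule that; (assumption | rule exI, assumption))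
  have gn: "homogeneous (int (d - 1)) (g j)" and fn: "homogeneous (int (d - 1)) (partial_deriv i f)" for i j
    using g homogeneous_partial_deriv[OF f, of i] d by (simp_all add: of_nat_diff)
  obtain u where u: "\<And>i. partial_deriv i f = (\<Sum>j\<in>UNIV. u i j * g j)" using u by metis
  have "\<forall>j. \<exists>q. g j = (\<Sum>i\<in>UNIV. q i * partial_deriv i f)"
    using jacobian_idealD g by blast
  from choice[OF this] obtain q where "\<forall>j. g j = (\<Sum>i\<in>UNIV. q j i * partial_deriv i f)"
    by (rule exE)
  note q = this[rule_format]
  define C :: "complex^3^3" where "C = (\<chi> i j. Poly_Mapping.lookup (u i j) 0)"
  define D :: "complex^3^3" where "D = (\<chi> j i. Poly_Mapping.lookup (q j i) 0)"
  have uC: "evaluate (partial_deriv i f) (vec_nth v) = (\<Sum>j\<in>UNIV. C $ i $ j * evaluate (g j) (vec_nth v))" for i v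
    using homogeneous_combination_constants[OF fn gn u] by (simp add: C_def)
  have qD: "evaluate (g j) (vec_nth v) = (\<Sum>i\<in>UNIV. D $ j $ i * evaluate (partial_deriv i f) (vec_nth v))" for j v
    using homogeneous_combination_constants[OF gn fn q] by (simp add: D_def)
  have "C ** D = mat 1"
  proof -
    \<comment> \<open>Substituting one family into the other makes each row of C D - 1 a constant
      linear relation among the partial derivatives.\<close>
    have rows: "row i (C ** D) - axis i 1 = 0" for i
    proof (rule indep)
      fix v
      have "(\<Sum>k\<in>UNIV. (C ** D) $ i $ k * evaluate (partial_deriv k f) (vec_nth v)) =
          (\<Sum>j\<in>UNIV. C $ i $ j * (\<Sum>k\<in>UNIV. D $ j $ k * evaluate (partial_deriv k f) (vec_nth v)))"
        unfolding matrix_matrix_mult_def sum_distrib_left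
        by (simp add: sum_distrib_right mult.assoc) (rule sum.swap)
      also have "\<dots> = evaluate (partial_deriv i f) (vec_nth v)"
        by (simp flip: qD uC)
      finally show "(\<Sum>k\<in>UNIV. (row i (C ** D) - axis i 1) $ k * evaluate (partial_deriv k f) (vec_nth v)) = 0"
        by (simp add: row_def left_diff_distrib sum_subtractf axis_def if_distrib[of "\<lambda>x. x * _"] cong: if_cong)
    qed
    have "(C ** D) $ i $ j = (mat 1 :: complex^3^3) $ i $ j" for i j
    proof -
      have "row i (C ** D) $ j = axis i 1 $ j"
        using rows[of i] by (simp only: right_minus_eq)
      thus ?thesis by (auto simp: row_def mat_def axis_def)
    qed
    thus ?thesis unfolding vec_eq_iff by blast
  qed
  hence DC: "D ** C = mat 1" using matrix_left_right_inverse by blast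
  define \<theta> where "\<theta> i = (\<Sum>j\<in>UNIV. h j * Poly_Mapping.single 0 (D $ j $ i))" for i
  have \<theta>: "evaluate (\<theta> i) w = (\<Sum>j\<in>UNIV. evaluate (h j) w * D $ j $ i)" for i w
    by (simp add: \<theta>_def)
  have "\<exists>i v. evaluate (\<theta> i) (vec_nth v) \<noteq> 0"
  proof (rule ccontr)
    assume neg: "\<nexists>i v. evaluate (\<theta> i) (vec_nth v) \<noteq> 0"
    obtain j w where jw: "evaluate (h j) w \<noteq> 0"
      using h(3) evaluate_not_identically_0 by blast
    define x :: "complex^3" where "x = (\<chi> j. evaluate (h j) w)"
    have "evaluate (\<theta> i) w = 0" for i
      using neg vec_nth_vec_lambda[of w] by metis
    hence "x v* D = 0"
      by (simp add: \<theta> x_def vector_matrix_mult_def vec_eq_iff mult.commute)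
    hence "x v* (D ** C) = 0"
      by (simp flip: vector_matrix_mul_assoc)
    hence "x = 0" by (simp add: DC)
    thus False using jw by (simp add: x_def vec_eq_iff)
  qed
  then obtain i0 v0 where "evaluate (\<theta> i0) (vec_nth v0) \<noteq> 0" by blast
  moreover have "homogeneous (int d1) (\<theta> i)" for i
    unfolding \<theta>_def using homogeneous_mult[OF spec[OF h(1)] homogeneous_const]
    by (intro homogeneous_sum) simp
  moreover have "(\<Sum>i\<in>UNIV. evaluate (\<theta> i) (vec_nth v) * evaluate (partial_deriv i f) (vec_nth v)) = 0" for v
  proof -
    have "(\<Sum>i\<in>UNIV. evaluate (\<theta> i) (vec_nth v) * evaluate (partial_deriv i f) (vec_nth v)) =
        (\<Sum>j\<in>UNIV. evaluate (h j) (vec_nth v) * (\<Sum>i\<in>UNIV. D $ j $ i * evaluate (partial_deriv i f) (vec_nth v)))"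
      unfolding \<theta> sum_distrib_left sum_distrib_right by (subst sum.swap) (simp add: mult.assoc)
    also have "\<dots> = evaluate (\<Sum>j\<in>UNIV. h j * g j) (vec_nth v)"
      by (simp flip: qD)
    finally show ?thesis by (simp add: h(2))
  qed
  ultimately show ?thesis by blast
qed

section \<open>Arrangements with at most triple points\<close>

lemma wirtinger_evaluate:
  "wirtinger (\<lambda>v::complex^3. evaluate p (vec_nth v))
     (\<lambda>k. evaluate (partial_deriv k p) (vec_nth v)) (\<lambda>_. 0) v"
  using has_derivative_evaluate[of p v] by (simp add: wirtinger_def)

lemma continuous_on_evaluate_vec: "continuous_on A (\<lambda>v::complex^3. evaluate p (vec_nth v))"
  by (intro continuous_intros)

lemma AE_linforms_nonzero:
  fixes a :: "'i \<Rightarrow> complex^'n"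
  assumes "finite I" and "\<And>i. i \<in> I \<Longrightarrow> a i \<noteq> 0"
  shows "AE v in lborel. \<forall>i\<in>I. linform (a i) v \<noteq> 0"
proof -
  have "AE v in lborel. linform (a i) v \<noteq> 0" if "i \<in> I" for i
    using null_set_linform_eq_0[OF assms(2)[OF that]] by (intro AE_not_in[THEN eventually_mono]) auto
  thus ?thesis using assms(1) by (intro AE_finite_allI)
qed

lemma powr_prod_cmod:
  fixes x :: "'i \<Rightarrow> complex"
  shows "(cmod (\<Prod>i\<in>I. x i))\<^sup>2 powr (- s) = (\<Prod>i\<in>I. cmod (x i) powr (-2 * s))"
proof -
  have "(cmod z)\<^sup>2 powr (- s) = cmod z powr (-2 * s)" for z
    by (cases "z = 0") (simp_all add: powr_powr flip: powr_numeral)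
  moreover have "cmod (\<Prod>i\<in>I. x i) powr (-2 * s) = (\<Prod>i\<in>I. cmod (x i) powr (-2 * s))"
    by (induction I rule: infinite_finite_induct) (simp_all add: norm_mult powr_mult)
  ultimately show ?thesis by simp
qed

lemma integrable_bump_prod_powr:
  fixes a :: "'i \<Rightarrow> complex^'n" and s :: real
  assumes fin: "finite I"
    and le3: "\<And>v. v \<noteq> 0 \<Longrightarrow> card {i\<in>I. linform (a i) v = 0} \<le> 3"
    and indep: "\<And>i j. i \<in> I \<Longrightarrow> j \<in> I \<Longrightarrow> i \<noteq> j \<Longrightarrow> \<exists>e. linform (a i) e = 1 \<and> linform (a j) e = 0"
    and s: "0 \<le> s" "3 * s < 2" and card: "3 \<le> card I"
  shows "integrable lborel
    (\<lambda>v. bump ((norm v)\<^sup>2) * (cmod (\<Prod>i\<in>I. linform (a i) v))\<^sup>2 powr (- s))"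
proof -
  \<comment> \<open>The closed shell avoids the origin, the only point where more than three of the
    forms can vanish.\<close>
  define K where "K = cball (0::complex^'n) 2 - ball 0 1"
  define F where "F v = (\<Prod>i\<in>I. cmod (linform (a i) v) powr (-2 * s))" for v
  have K: "compact K" unfolding K_def by (intro compact_diff) auto
  have "set_integrable lborel K F"
    unfolding F_def
  proof (rule set_integrable_prod_powr_forms[OF fin K _ indep s card])
    fix v assume "v \<in> K"
    hence "v \<noteq> 0" by (auto simp: K_def)
    thus "card {i\<in>I. linform (a i) v = 0} \<le> 3" by (rule le3)
  qed
  hence int: "integrable lborel (\<lambda>v. 9 * (indicat_real K v *\<^sub>R F v))"
    unfolding set_integrable_def by (intro integrable_mult_right)
  have [measurable]: "(\<lambda>v::complex^'n. bump ((norm v)\<^sup>2)) \<in> borel_measurable borel"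
    unfolding bump_def by measurable
  have [measurable]: "F \<in> borel_measurable borel"
    unfolding F_def by measurable
  have le: "norm (bump ((norm v)\<^sup>2) * F v) \<le> norm (9 * (indicat_real K v *\<^sub>R F v))" for v
  proof (cases "bump ((norm v)\<^sup>2) > 0")
    case True
    hence "v \<in> K" by (auto simp: bump_pos_iff K_def)
    \<comment> \<open>The maximum of (t - 1) (4 - t) is 9/4, at t = 5/2; the cruder bound 3 gives 9
      after squaring.\<close>
    have "bump t \<le> 9" for t
    proof -
      have "(t - 1) * (4 - t) \<le> 3"
        using sum_squares_ge_zero[of "t - 5/2" 0] by (simp add: algebra_simps)
      hence "(max 0 ((t - 1) * (4 - t)))\<^sup>2 \<le> 3\<^sup>2" by (intro power_mono) auto
      thus ?thesis by (simp add: bump_def)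
    qed
    hence "bump ((norm v)\<^sup>2) * \<bar>F v\<bar> \<le> 9 * \<bar>F v\<bar>" by (intro mult_right_mono) auto
    thus ?thesis using \<open>v \<in> K\<close> True by (simp add: abs_mult)
  next
    case False
    hence "bump ((norm v)\<^sup>2) = 0" using bump_nonneg[of "(norm v)\<^sup>2"] by linarith
    thus ?thesis by simp
  qed
  have "integrable lborel (\<lambda>v. bump ((norm v)\<^sup>2) * F v)"
    by (rule Bochner_Integration.integrable_bound[OF int _ AE_I2[OF le]]) measurable
  thus ?thesis unfolding powr_prod_cmod F_def .
qed

text \<open>For s = (r + 2) / d, with d the number of forms, the last hypothesis says 3 s < 2.
  Integration gives vanishing on the shell only; homogeneity carries it to every nonzero vector, and
  at the origin the positive degree suffices.\<close>

lemma derivation_tangent_to_triple_arrangement_eq_0: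
  fixes a :: "'i \<Rightarrow> complex^3" and \<theta> :: "3 \<Rightarrow> poly3"
  assumes fin: "finite I"
    and le3: "\<And>v. v \<noteq> 0 \<Longrightarrow> card {i\<in>I. linform (a i) v = 0} \<le> 3"
    and indep: "\<And>i j. i \<in> I \<Longrightarrow> j \<in> I \<Longrightarrow> i \<noteq> j \<Longrightarrow> \<exists>e. linform (a i) e = 1 \<and> linform (a j) e = 0"
    and a0: "\<And>i. i \<in> I \<Longrightarrow> a i \<noteq> 0"
    and f: "\<And>v. evaluate f (vec_nth v) = (\<Prod>i\<in>I. linform (a i) v)"
    and hom_f: "homogeneous (int (card I)) f"
    and \<theta>: "\<And>i. homogeneous (int r) (\<theta> i)"
    and tang: "\<And>v. (\<Sum>i\<in>UNIV. evaluate (\<theta> i) (vec_nth v) * evaluate (partial_deriv i f) (vec_nth v)) = 0"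
    and card: "3 \<le> card I" and r0: "1 \<le> r" and r: "3 * (r + 2) < 2 * card I"
  shows "evaluate (\<theta> i) (vec_nth v) = 0"
proof -
  define s where "s = (real r + 2) / real (card I)"
  have s: "0 \<le> s" "3 * s < 2"
    using card r by (auto simp: s_def field_simps)
  interpret tf: tangent_field "\<lambda>v. evaluate f (vec_nth v)" "\<lambda>v k. evaluate (partial_deriv k f) (vec_nth v)"
    "\<lambda>i v. evaluate (\<theta> i) (vec_nth v)" "\<lambda>i v k. evaluate (partial_deriv k (\<theta> i)) (vec_nth v)" "card I" r s
  proof
    show "s * real (card I) = real r + real CARD(3) - 1"
      using card by (auto simp: s_def)
  qed (use wirtinger_evaluate continuous_on_evaluate_vec euler_identity[OF hom_f] euler_identity[OF \<theta>] tang in auto)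
  have shell: "evaluate (\<theta> i) (vec_nth w) = 0" if "1 < norm w" "norm w < 2" for w
  proof (rule tf.tangent_field_vanishes[OF _ _ s(1) _ _ _ that])
    show "wirtinger tf.L (\<lambda>j. \<Sum>k\<in>UNIV. evaluate (partial_deriv j (partial_deriv k (\<theta> k))) (vec_nth v)) (\<lambda>_. 0) v" for v
    proof -
      have "wirtinger tf.L (\<lambda>j. \<Sum>k\<in>UNIV. evaluate (partial_deriv j (partial_deriv k (\<theta> k))) (vec_nth v))
          (\<lambda>_. \<Sum>k\<in>(UNIV::3 set). 0) v"
        unfolding tf.L_def by (intro wirtinger_sum wirtinger_evaluate)
      thus ?thesis by simp
    qed
    show "continuous_on UNIV (\<lambda>v::complex^3. \<Sum>k\<in>UNIV. evaluate (partial_deriv j (partial_deriv k (\<theta> k))) (vec_nth v))" for j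
      by (intro continuous_on_sum continuous_on_evaluate_vec)
    show "0 < card I" using card by simp
    show "integrable lborel (\<lambda>v. bump ((norm v)\<^sup>2) * (cmod (evaluate f (vec_nth v)))\<^sup>2 powr (- s))"
      unfolding f by (rule integrable_bump_prod_powr[OF fin le3 indep s card])
    show "AE v in lborel. evaluate f (vec_nth v) \<noteq> 0"
      using AE_linforms_nonzero[OF fin a0] fin by (auto simp: f elim: eventually_mono)
  qed
  show ?thesis
  proof (cases "v = 0")
    case False
    define t where "t = complex_of_real (3 / 2 / norm v)"
    have "norm (t *s v) = 3 / 2"
      using False unfolding norm_smult t_def norm_of_real by simp
    hence "evaluate (\<theta> i) (vec_nth (t *s v)) = 0" by (intro shell) auto
    moreover have "evaluate (\<theta> i) (vec_nth (t *s v)) = t ^ r * evaluate (\<theta> i) (vec_nth v)"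
      using evaluate_homogeneous[OF \<theta>, of i t "vec_nth v"] by (simp add: vector_scalar_mult_def vec_nth_vec_lambda)
    ultimately show ?thesis using False by (simp add: t_def)
  next
    case True
    have "evaluate (\<theta> i) (\<lambda>j. 0 * v $ j) = 0 ^ r * evaluate (\<theta> i) (vec_nth v)"
      by (rule evaluate_homogeneous[OF \<theta>])
    moreover have "vec_nth v = (\<lambda>j. 0 * v $ j)" using True by (simp add: fun_eq_iff)
    moreover have "(0::complex) ^ r = 0" using r0 by simp
    ultimately show ?thesis by simp
  qed
qed

theorem corollary3p2:
  fixes \<L> :: "point set set" and d :: nat
  assumes "plus_one_generated_arrangement \<L>"
    and "card \<L> = d"
    and "d > 12"
  shows "max_multiplicity \<L> \<ge> 4"
proof (rule ccontr)
  assume "\<not> ?thesis"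
  hence m3: "max_multiplicity \<L> \<le> 3" by simp
  from assms obtain f d1 d2 d3 where arr: "line_arrangement \<L>" and def_f: "defining_polynomial \<L> f"
    and pog: "plus_one_generated_curve d f d1 d2 d3"
    by (auto simp: plus_one_generated_arrangement_def)
  have fin: "finite \<L>" using arr by (simp add: line_arrangement_def)
  from def_f obtain l where l: "\<And>L. L \<in> \<L> \<Longrightarrow> linear_form (l L)" "\<And>L. L \<in> \<L> \<Longrightarrow> zero_locus (l L) = L"
    and f_eq: "f = (\<Prod>L\<in>\<L>. l L)"
    by (auto simp: defining_polynomial_def)
  have "\<forall>L\<in>\<L>. \<exists>a. a \<noteq> 0 \<and> (\<forall>v. evaluate (l L) (vec_nth v) = linform a v)"
    using linear_form_imp_linform l(1) by metis
  then obtain a where a: "\<And>L. L \<in> \<L> \<Longrightarrow> a L \<noteq> 0"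
    "\<And>L v. L \<in> \<L> \<Longrightarrow> evaluate (l L) (vec_nth v) = linform (a L) v"
    by metis
  have f: "evaluate f (vec_nth v) = (\<Prod>L\<in>\<L>. linform (a L) v)" for v
    using a(2) by (simp add: f_eq)
  have hom_f: "homogeneous (int (card \<L>)) f"
    using homogeneous_prod[of \<L> 1 l] l(1) by (simp add: f_eq linear_form_def)
  have on_line: "span_point v \<in> L \<longleftrightarrow> linform (a L) v = 0" if "L \<in> \<L>" "v \<noteq> 0" for L v
    using span_point_in_zero_locus[OF l(1)[OF that(1)] that(2)] l(2) a(2) that by simp
  have le3: "card {L\<in>\<L>. linform (a L) v = 0} \<le> 3" if "v \<noteq> 0" for v
  proof -
    have "{L\<in>\<L>. linform (a L) v = 0} = {L\<in>\<L>. span_point v \<in> L}"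
      using on_line that by auto
    thus ?thesis using card_lines_through_le[OF fin m3] by simp
  qed
  have indep: "\<exists>e. linform (a L) e = 1 \<and> linform (a L') e = 0"
    if "L \<in> \<L>" "L' \<in> \<L>" "L \<noteq> L'" for L L'
    by (rule distinct_lines_separated[of "l L" "l L'"]) (use l a that in auto)
  \<comment> \<open>A linear relation says that \<open>f\<close> is constant in the direction
    \<open>y\<close>. Some line's form is nonzero at \<open>y\<close>, because at most three vanish
    there and d > 12. Moving along \<open>y\<close> from a point off all lines then reaches that
    line, where \<open>f\<close> is 0.\<close>
  have indep_partials: "y = 0"
    if y: "\<And>v. (\<Sum>i\<in>UNIV. y $ i * evaluate (partial_deriv i f) (vec_nth v)) = 0" for y :: "complex^3"
  proof (rule ccontr)
    assume "y \<noteq> 0"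
    have "{L\<in>\<L>. linform (a L) y = 0} \<noteq> \<L>"
      using le3[OF \<open>y \<noteq> 0\<close>] assms(2,3) by auto
    then obtain L where L: "L \<in> \<L>" "linform (a L) y \<noteq> 0" by blast
    \<comment> \<open>Finitely many hyperplanes have measure zero and so do not cover the
      space.\<close>
    have "\<exists>v. \<forall>L\<in>\<L>. linform (a L) v \<noteq> 0"
    proof (rule ccontr)
      assume "\<not> ?thesis"
      moreover have "AE v in lborel. \<forall>L\<in>\<L>. linform (a L) v \<noteq> 0"
        by (rule AE_linforms_nonzero[OF fin]) (rule a(1))
      ultimately have "AE v in lborel. (v::complex^3) \<notin> UNIV"
        by (auto elim: eventually_mono)
      from open_null_set_empty[OF open_UNIV this] show False by simp
    qed
    then obtain v where v: "\<forall>L\<in>\<L>. linform (a L) v \<noteq> 0" by blast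
    have "((\<lambda>t. evaluate f (vec_nth (v + t *s y))) has_field_derivative 0) (at t)" for t
    proof -
      have "linear (\<lambda>h. h *s y)"
        by (rule linearI) (simp_all add: vec_eq_iff algebra_simps)
      hence "((\<lambda>h. h *s y) has_derivative (\<lambda>h. h *s y)) (at t)"
        by (intro bounded_linear_imp_has_derivative) (simp add: linear_conv_bounded_linear)
      hence "((\<lambda>h. v + h *s y) has_derivative (\<lambda>h. h *s y)) (at t)"
        by (auto intro!: derivative_eq_intros)
      from has_derivative_compose[OF this has_derivative_evaluate[of f]]
      have "((\<lambda>t. evaluate f (vec_nth (v + t *s y))) has_derivative
          (\<lambda>h. \<Sum>i\<in>UNIV. evaluate (partial_deriv i f) (vec_nth (v + t *s y)) * (h *s y) $ i)) (at t)" .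
      moreover have "(\<Sum>i\<in>UNIV. evaluate (partial_deriv i f) (vec_nth (v + t *s y)) * (h *s y) $ i) = 0" for h
      proof -
        have "(\<Sum>i\<in>UNIV. evaluate (partial_deriv i f) (vec_nth (v + t *s y)) * (h *s y) $ i) =
            h * (\<Sum>i\<in>UNIV. y $ i * evaluate (partial_deriv i f) (vec_nth (v + t *s y)))"
          unfolding sum_distrib_left by (intro sum.cong refl) (simp only: vector_smult_component mult_ac)
        thus ?thesis by (simp only: y mult_zero_right)
      qed
      ultimately show ?thesis by (simp add: has_field_derivative_def lambda_zero)
    qed
    hence "\<exists>c. \<forall>t\<in>UNIV. evaluate f (vec_nth (v + t *s y)) = c"
      by (intro has_field_derivative_zero_constant) auto
    then obtain c where c: "evaluate f (vec_nth (v + t *s y)) = c" for t by blast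
    have const: "evaluate f (vec_nth (v + t *s y)) = evaluate f (vec_nth v)" for t
      using c[of t] c[of 0] by simp
    define t where "t = - linform (a L) v / linform (a L) y"
    have "linform (a L) (v + t *s y) = 0"
      unfolding linform_add linform_smult using L by (simp add: t_def)
    hence "evaluate f (vec_nth (v + t *s y)) = 0"
      using L fin by (auto simp: f intro!: prod_zero)
    moreover have "evaluate f (vec_nth v) \<noteq> 0" using v fin by (simp add: f)
    ultimately show False using const[of t] by simp
  qed
  obtain \<theta> :: "3 \<Rightarrow> poly3" where \<theta>: "\<And>i. homogeneous (int d1) (\<theta> i)"
    "\<And>v. (\<Sum>i\<in>UNIV. evaluate (\<theta> i) (vec_nth v) * evaluate (partial_deriv i f) (vec_nth v)) = 0"
    "\<exists>i v. evaluate (\<theta> i) (vec_nth v) \<noteq> 0"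
    using exists_tangent_derivation[OF pog _ _ indep_partials] hom_f assms(2,3) by auto
  have "1 \<le> d1" "2 * d1 \<le> d"
    using plus_one_generated_first_syzygy(2,3)[OF pog] by simp_all
  \<comment> \<open>The constant 12 arises here: 6 (d1 + 2) \<le> 3 d + 12 < 4 d exactly when d > 12
    in the last inequality, and this gives 3 (d1 + 2) < 2 d.\<close>
  hence "evaluate (\<theta> i) (vec_nth v) = 0" for i v
    using assms(2,3)
    by (intro derivation_tangent_to_triple_arrangement_eq_0[OF fin le3 indep a(1) f hom_f \<theta>(1,2)]) auto
  with \<theta>(3) show False by blast
qed

end
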